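(* Let $(X,\|\cdot\|)$ be a real Banach space and let $A$ be a nonempty, (norm) open, convex subset of $X^*$. If $\varphi:A\to\mathbb{R}$ is a continuous, convex function and $\partial\varphi(x^* )\cap\widehat{X}\neq\varnothing$ for all $x^*\in A$, then $\partial\varphi(x^* )\subseteq\widehat{X}$ for all $x^*\in A$.
   Context: $X^*$ and $X^{**}$ denote the continuous dual and bidual of $X$ with their operator norms; continuity of $\varphi$ is with respect to the norm topology on $X^*$. For $x\in X$, $\widehat{x}\in X^{**}$ is defined by $\widehat{x}(x^* ):=x^*(x)$, and $\widehat{X}:=\{\widehat{x}:x\in X\}\subseteq X^{**}$. For $x^*\in A$ the subdifferential of $\varphi$ at $x^*$ is $\partial\varphi(x^* ):=\{F\in X^{**}: F(y^* )-F(x^* )\leq\varphi(y^* )-\varphi(x^* )\text{ for all }y^*\in A\}$. *)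

theory Defs
  imports "HOL-Analysis.Analysis"
begin

type_synonym 'a dual = "'a \<Rightarrow>\<^sub>L real"

type_synonym 'a bidual = "('a \<Rightarrow>\<^sub>L real) \<Rightarrow>\<^sub>L real"

definition hat :: "'a::real_normed_vector \<Rightarrow> 'a bidual" where
  "hat x = Blinfun (\<lambda>f. blinfun_apply f x)"

text \<open>Boundedness of evaluation, so that \<^term>\<open>Blinfun\<close> above is not applied outside its domain.\<close>

lemma hat_apply [simp]: "blinfun_apply (hat x) f = blinfun_apply f x"
  by (simp add: hat_def bounded_linear_Blinfun_apply blinfun.bounded_linear_left)

text \<open>A function \<^term>\<open>\<phi>\<close> on \<^term>\<open>A\<close> is represented by a total function of which
  only the values on \<^term>\<open>A\<close> are used.\<close>

definition subdiff :: "('a::real_normed_vector) dual set \<Rightarrow> ('a dual \<Rightarrow> real) \<Rightarrow> 'a dual \<Rightarrow> 'a bidual set"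
  where
  "subdiff A \<phi> x =
    {F. \<forall>y\<in>A. blinfun_apply F y - blinfun_apply F x \<le> \<phi> y - \<phi> x}"

end

theory Submission
  imports Defs "HOL-Library.Diagonal_Subsequence"
begin

text \<open>
  The theorem contains James's theorem on weakly compact sets: for a bounded closed convex
  set \<open>C\<close>, the supremum \<open>\<phi> f\<close> of \<open>f\<close> over \<open>C\<close> is sublinear in \<open>f\<close>; it has a subgradient in
  the image of the space at every \<open>f\<close> that attains its supremum on \<open>C\<close>, and its
  subdifferential at 0 is the weak-star closure of \<open>C\<close>. The proof adapts to convex functions
  the argument of James in the form given to it by Pryce, in which sublinearity serves only
  through convexity.

  The claim is local, so \<open>\<phi>\<close> may be taken to be Lipschitz on the ball of radius 2 around 0,
  with \<open>F\<close> a subgradient at 0. The image of the Banach space is closed in the bidual. Hence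
  if \<open>F\<close> is not in it, then \<open>F\<close> has distance greater than some \<open>\<theta> > 0\<close> from it, and Helly's
  theorem (annihilating_functional_near_distance) provides functionals in the unit ball on
  which \<open>F\<close> exceeds \<open>\<theta>\<close> and which vanish at finitely many prescribed points. Prescribing
  subgradients of \<open>\<phi>\<close> at convex combinations of the functionals already chosen gives a
  sequence \<open>f n\<close> such that, for all its convex combinations \<open>k\<close> and all functionals \<open>h\<close>
  lying pointwise between its lower and upper limits, \<open>\<phi> ((k - h) / 2) \<ge> \<phi> 0 + \<theta> / 2\<close>
  (sequence_vanishing_on_subgradients, le_after_subtracting_limit_functional).

  Such an \<open>h\<close> stands in for a weak-star limit, and it has the defect of depending on the
  sequence. Passing to a diagonal subsequence removes the defect as far as \<open>\<phi>\<close> can tell: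
  afterwards the relevant values \<open>\<phi> (v - c h)\<close> are the same for all \<open>h\<close>
  (subseq_no_oscillation).

  Now choose convex combinations \<open>g n\<close> of the tails of the sequence, nearly minimal in a
  suitable sense, and sum \<open>g n - h\<close> with very rapidly decreasing weights. Along the partial
  sums \<open>\<phi>\<close> increases in proportion to the weights, so that a subgradient \<open>x\<close> at the limit
  point, which exists in the space by hypothesis, satisfies \<open>g n x \<ge> h x + \<theta> / 4\<close> for all
  large \<open>n\<close>. Since \<open>h\<close> can be chosen to be a limit functional of \<open>g\<close>, this is a
  contradiction (no_uniform_increase).
\<close>

section \<open>The Hahn--Banach theorem\<close>

definition sublinear :: "('v::real_vector \<Rightarrow> real) \<Rightarrow> bool" where
  "sublinear p \<longleftrightarrow>
     (\<forall>x y. p (x + y) \<le> p x + p y) \<and> (\<forall>t x. 0 \<le> t \<longrightarrow> p (t *\<^sub>R x) \<le> t * p x)"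

lemma sublinearI:
  assumes "\<And>x y. p (x + y) \<le> p x + p y" and "\<And>t x. 0 \<le> t \<Longrightarrow> p (t *\<^sub>R x) \<le> t * p x"
  shows "sublinear p"
  using assms unfolding sublinear_def by blast

lemma sublinear_add: "sublinear p \<Longrightarrow> p (x + y) \<le> p x + p y"
  and sublinear_scale_le: "sublinear p \<Longrightarrow> 0 \<le> t \<Longrightarrow> p (t *\<^sub>R x) \<le> t * p x"
  unfolding sublinear_def by blast+

lemma sublinear_zero: "sublinear p \<Longrightarrow> p 0 = 0"
  using sublinear_add[of p 0 0] sublinear_scale_le[of p 0 0] by simp

lemma sublinear_scale:
  assumes "sublinear p" "0 \<le> t"
  shows "p (t *\<^sub>R x) = t * p x"
proof (cases "t = 0")
  case True
  then show ?thesis using sublinear_zero[OF assms(1)] by simp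
next
  case False
  then have "0 < t" using assms(2) by simp
  have "p ((1 / t) *\<^sub>R (t *\<^sub>R x)) \<le> (1 / t) * p (t *\<^sub>R x)"
    using sublinear_scale_le[OF assms(1)] \<open>0 < t\<close> by (metis less_imp_le zero_less_divide_1_iff)
  then have "t * p x \<le> p (t *\<^sub>R x)" using \<open>0 < t\<close> by (simp add: field_simps)
  then show ?thesis using sublinear_scale_le[OF assms, of x] by simp
qed

lemma sublinear_minus_le: "sublinear p \<Longrightarrow> - p (- x) \<le> p x"
  using sublinear_add[of p x "- x"] sublinear_zero[of p] by simp

lemma le_INF_add:
  fixes f :: "'i \<Rightarrow> real" and g :: "'j \<Rightarrow> real"
  assumes "I \<noteq> {}" "J \<noteq> {}" and le: "\<And>i j. i \<in> I \<Longrightarrow> j \<in> J \<Longrightarrow> c \<le> f i + g j"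
  shows "c \<le> (INF i\<in>I. f i) + (INF j\<in>J. g j)"
proof -
  have "c - f i \<le> (INF j\<in>J. g j)" if "i \<in> I" for i
    by (rule cINF_greatest[OF assms(2)]) (use le[OF that] in \<open>simp add: algebra_simps\<close>)
  then have "c - (INF j\<in>J. g j) \<le> (INF i\<in>I. f i)"
    by (intro cINF_greatest[OF assms(1)]) (simp add: algebra_simps)
  then show ?thesis by simp
qed

text \<open>
  The construction behind both halves of Hahn--Banach: \<open>q\<close> is the largest sublinear
  functional below \<open>p\<close> that is at most \<open>- g t\<close> at \<open>- T t\<close>. Minimality of a sublinear
  functional is tested with \<open>Y\<close> a half-line, and an extension of \<open>g\<close> is obtained with \<open>Y\<close> a
  subspace and \<open>T\<close> the inclusion; this is why \<open>Y\<close> is only a convex cone.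
\<close>

lemma sublinear_INF_translates:
  fixes p :: "'v::real_vector \<Rightarrow> real" and g :: "'w::real_vector \<Rightarrow> real" and T :: "'w \<Rightarrow> 'v"
  assumes p: "sublinear p" and T: "linear T"
    and ne: "0 \<in> Y" and add: "\<And>s t. s \<in> Y \<Longrightarrow> t \<in> Y \<Longrightarrow> s + t \<in> Y"
    and scale: "\<And>c t. 0 \<le> c \<Longrightarrow> t \<in> Y \<Longrightarrow> c *\<^sub>R t \<in> Y"
    and g_add: "\<And>s t. s \<in> Y \<Longrightarrow> t \<in> Y \<Longrightarrow> g (s + t) = g s + g t"
    and g_scale: "\<And>c t. 0 \<le> c \<Longrightarrow> t \<in> Y \<Longrightarrow> g (c *\<^sub>R t) = c * g t"
    and dom: "\<And>t. t \<in> Y \<Longrightarrow> g t \<le> p (T t)"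
  defines "q \<equiv> \<lambda>x. INF t\<in>Y. p (x + T t) - g t"
  shows "sublinear q" and "\<And>x t. t \<in> Y \<Longrightarrow> q x \<le> p (x + T t) - g t"
proof -
  interpret T: linear T by fact
  have bdd: "bdd_below ((\<lambda>t. p (x + T t) - g t) ` Y)" for x
  proof (rule bdd_belowI2)
    fix t assume "t \<in> Y"
    have "p (T t) \<le> p (x + T t) + p (- x)"
      using sublinear_add[OF p, of "x + T t" "- x"] by simp
    then show "- p (- x) \<le> p (x + T t) - g t" using dom[OF \<open>t \<in> Y\<close>] by linarith
  qed
  show le: "q x \<le> p (x + T t) - g t" if "t \<in> Y" for x t
    unfolding q_def by (rule cINF_lower[OF bdd that])
  have Y: "Y \<noteq> {}" using ne by blast
  have q_eq: "q x = (INF t\<in>Y. p (x + T t) - g t)" for x by (simp add: q_def)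
  show "sublinear q"
  proof (rule sublinearI)
    fix x y
    show "q (x + y) \<le> q x + q y"
      unfolding q_eq[of x] q_eq[of y]
    proof (rule le_INF_add[OF Y Y])
      fix s t assume st: "s \<in> Y" "t \<in> Y"
      have "q (x + y) \<le> p ((x + T s) + (y + T t)) - g (s + t)"
        using le[OF add[OF st], of "x + y"] by (simp add: T.add algebra_simps)
      also have "\<dots> \<le> (p (x + T s) - g s) + (p (y + T t) - g t)"
        using sublinear_add[OF p, of "x + T s" "y + T t"] g_add[OF st] by simp
      finally show "q (x + y) \<le> (p (x + T s) - g s) + (p (y + T t) - g t)" .
    qed
  next
    fix c :: real and x assume c: "0 \<le> c"
    show "q (c *\<^sub>R x) \<le> c * q x"
    proof (cases "c = 0")
      case True
      have "g 0 = 0" using g_scale[of 0 0] ne by simp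
      then have "q 0 \<le> 0" using le[OF ne, of 0] sublinear_zero[OF p] by (simp add: T.zero)
      then show ?thesis using True by simp
    next
      case False
      then have c0: "0 < c" using c by simp
      have "q (c *\<^sub>R x) / c \<le> p (x + T t) - g t" if "t \<in> Y" for t
      proof -
        have "q (c *\<^sub>R x) \<le> p (c *\<^sub>R (x + T t)) - g (c *\<^sub>R t)"
          using le[OF scale[OF c that], of "c *\<^sub>R x"] by (simp add: T.scale scaleR_add_right)
        also have "\<dots> = c * (p (x + T t) - g t)"
          using sublinear_scale[OF p c] g_scale[OF c that] by (simp add: right_diff_distrib)
        finally show ?thesis using c0 by (simp add: field_simps)
      qed
      then have "q (c *\<^sub>R x) / c \<le> q x" unfolding q_eq[of x]
        by (intro cINF_greatest[OF Y]) auto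
      then show ?thesis using c0 by (simp add: field_simps)
    qed
  qed
qed

text \<open>
  Zorn's lemma applies because a sublinear \<open>q \<le> p\<close> satisfies \<open>q x \<ge> - p (- x)\<close>, so that a
  chain has a pointwise infimum; two members of a chain are comparable, and this makes the
  infimum subadditive.
\<close>

lemma minimal_sublinear_below:
  fixes p :: "'v::real_vector \<Rightarrow> real"
  assumes p: "sublinear p"
  obtains m where "sublinear m" "\<And>x. m x \<le> p x"
    "\<And>q x. sublinear q \<Longrightarrow> (\<And>y. q y \<le> m y) \<Longrightarrow> q x = m x"
proof -
  define S where "S = {q. sublinear q \<and> (\<forall>x. q x \<le> p x)}"
  define below :: "('v \<Rightarrow> real) \<Rightarrow> ('v \<Rightarrow> real) \<Rightarrow> bool" where "below q r \<longleftrightarrow> (\<forall>x. r x \<le> q x)" for q r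
  have "\<exists>m\<in>S. \<forall>q\<in>S. below m q \<longrightarrow> q = m"
  proof (rule predicate_Zorn)
    show "partial_order_on S (relation_of below S)"
    proof (rule partial_order_on_relation_ofI)
      show "q = r" if "below q r" "below r q" for q r
        using that by (auto simp: below_def intro: antisym)
    qed (auto simp: below_def intro: order_trans)
    fix C assume "C \<in> Chains (relation_of below S)"
    then have CS: "C \<subseteq> S"
      and tot: "\<And>q r. q \<in> C \<Longrightarrow> r \<in> C \<Longrightarrow> (\<forall>x. r x \<le> q x) \<or> (\<forall>x. q x \<le> r x)"
      unfolding Chains_def relation_of_def below_def by blast+
    show "\<exists>u\<in>S. \<forall>q\<in>C. below q u"
    proof (cases "C = {}")
      case True
      then show ?thesis using p by (auto simp: S_def)
    next
      case False
      define u where "u x = (INF q\<in>C. q x)" for x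
      have sub: "sublinear q" and lep: "q x \<le> p x" if "q \<in> C" for q x
        using CS that by (auto simp: S_def)
      have bdd: "bdd_below ((\<lambda>q. q x) ` C)" for x
      proof (rule bdd_belowI2)
        fix q assume "q \<in> C"
        show "- p (- x) \<le> q x"
          using sublinear_minus_le[OF sub[OF \<open>q \<in> C\<close>], of x] lep[OF \<open>q \<in> C\<close>, of "- x"] by linarith
      qed
      have le: "u x \<le> q x" if "q \<in> C" for q x
        unfolding u_def by (rule cINF_lower[OF bdd that])
      have "sublinear u"
      proof (rule sublinearI)
        fix x y
        show "u (x + y) \<le> u x + u y" unfolding u_def[of x] u_def[of y]
        proof (rule le_INF_add[OF False False])
          fix q r assume qr: "q \<in> C" "r \<in> C"
          then consider "\<forall>x. r x \<le> q x" | "\<forall>x. q x \<le> r x" using tot by blast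
          then show "u (x + y) \<le> q x + r y"
          proof cases
            case 1
            have "u (x + y) \<le> r x + r y"
              using le[OF qr(2)] sublinear_add[OF sub[OF qr(2)]] by (rule order_trans)
            then show ?thesis using 1[rule_format, of x] by linarith
          next
            case 2
            have "u (x + y) \<le> q x + q y"
              using le[OF qr(1)] sublinear_add[OF sub[OF qr(1)]] by (rule order_trans)
            then show ?thesis using 2[rule_format, of y] by linarith
          qed
        qed
      next
        fix t :: real and x assume t: "0 \<le> t"
        obtain q where q: "q \<in> C" using False by blast
        show "u (t *\<^sub>R x) \<le> t * u x"
        proof (cases "t = 0")
          case True
          then show ?thesis using le[OF q, of 0] sublinear_zero[OF sub[OF q]] by simp
        next
          case nz: False
          then have "u (t *\<^sub>R x) / t \<le> q x" if "q \<in> C" for q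
            using le[OF that, of "t *\<^sub>R x"] sublinear_scale[OF sub[OF that] t, of x] t
            by (simp add: field_simps)
          then have "u (t *\<^sub>R x) / t \<le> u x" unfolding u_def[of x]
            by (intro cINF_greatest[OF False]) auto
          then show ?thesis using nz t by (simp add: field_simps)
        qed
      qed
      moreover have "u x \<le> p x" for x
        using False le lep by (meson ex_in_conv order_trans)
      ultimately have "u \<in> S" by (simp add: S_def)
      then show ?thesis using le by (auto simp: below_def)
    qed
  qed
  then obtain m where m: "m \<in> S" "\<And>q. q \<in> S \<Longrightarrow> below m q \<Longrightarrow> q = m" by blast
  show ?thesis
  proof (rule that[of m])
    show "sublinear m" "\<And>x. m x \<le> p x" using m(1) by (auto simp: S_def)
    fix q x assume "sublinear q" and qm: "\<And>y. q y \<le> m y"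
    moreover have "q y \<le> p y" for y using qm m(1) order_trans unfolding S_def by blast
    ultimately show "q x = m x" using m(2)[of q] by (simp add: S_def below_def)
  qed
qed

text \<open>
  A minimal sublinear \<open>m\<close> is linear. For fixed \<open>y\<close>, the infimum over \<open>t \<ge> 0\<close> of
  \<open>m (x + t y) - t m y\<close> is sublinear in \<open>x\<close> and lies below \<open>m\<close>, hence equals \<open>m x\<close>; its term
  for \<open>t = 1\<close> gives superadditivity.
\<close>

lemma linear_below_sublinear:
  fixes p :: "'v::real_vector \<Rightarrow> real"
  assumes "sublinear p"
  obtains h where "linear h" "\<And>x. h x \<le> p x"
proof -
  obtain m where m: "sublinear m" and mp: "\<And>x. m x \<le> p x"
    and mini: "\<And>q x. sublinear q \<Longrightarrow> (\<And>y. q y \<le> m y) \<Longrightarrow> q x = m x"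
    using minimal_sublinear_below[OF assms] by metis
  have super: "m x + m y \<le> m (x + y)" for x y
  proof -
    define q where "q x = (INF t\<in>{0::real..}. m (x + t *\<^sub>R y) - t * m y)" for x
    have T: "linear (\<lambda>t::real. t *\<^sub>R y)" by (simp add: linear_iff scaleR_add_left)
    note q = sublinear_INF_translates[OF m T, where Y = "{0..}" and g = "\<lambda>t. t * m y", folded q_def]
    have "sublinear q" and le: "q x \<le> m (x + t *\<^sub>R y) - t * m y" if "0 \<le> t" for x t
      by (rule q; use that in \<open>simp add: sublinear_scale[OF m] algebra_simps\<close>)+
    then have "sublinear q" by blast
    then have "q x = m x"
      using mini le[of 0] by simp
    then show ?thesis using le[of 1 x] by simp
  qed
  have add: "m (x + y) = m x + m y" for x y
    using super[of x y] sublinear_add[OF m, of x y] by simp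
  have neg: "m (- x) = - m x" for x
    using add[of x "- x"] sublinear_zero[OF m] by simp
  have "m (t *\<^sub>R x) = t * m x" for t x
  proof (cases "0 \<le> t")
    case True
    then show ?thesis by (rule sublinear_scale[OF m])
  next
    case False
    then show ?thesis using sublinear_scale[OF m, of "- t" x] neg[of "(- t) *\<^sub>R x"] by simp
  qed
  then have "linear m" using add by (intro linearI) auto
  then show ?thesis using mp that by blast
qed

text \<open>
  Any linear functional below the infimum over \<open>t \<in> Y\<close> of \<open>p (x + t) - g t\<close> lies below \<open>p\<close>
  (take \<open>t = 0\<close>) and below \<open>g\<close> on \<open>Y\<close> (take \<open>t = - x\<close>); on a subspace the latter forces
  equality.
\<close>

theorem hahn_banach:
  fixes p :: "'v::real_vector \<Rightarrow> real"
  assumes p: "sublinear p" and Y: "subspace Y"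
    and g_add: "\<And>s t. s \<in> Y \<Longrightarrow> t \<in> Y \<Longrightarrow> g (s + t) = g s + g t"
    and g_scale: "\<And>c t. t \<in> Y \<Longrightarrow> g (c *\<^sub>R t) = c * g t"
    and dom: "\<And>t. t \<in> Y \<Longrightarrow> g t \<le> p t"
  obtains h where "linear h" "\<And>x. h x \<le> p x" "\<And>t. t \<in> Y \<Longrightarrow> h t = g t"
proof -
  define q where "q x = (INF t\<in>Y. p (x + t) - g t)" for x
  note Q = sublinear_INF_translates[OF p linear_ident, where Y = Y and g = g, folded q_def]
  have q: "sublinear q" and le: "\<And>x t. t \<in> Y \<Longrightarrow> q x \<le> p (x + t) - g t"
    by (rule Q; use Y g_add g_scale dom in \<open>simp add: subspace_0 subspace_add subspace_scale\<close>)+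
  obtain h where h: "linear h" and hq: "\<And>x. h x \<le> q x"
    using linear_below_sublinear[OF q] by metis
  have g0: "g 0 = 0" using g_scale[of 0 0] subspace_0[OF Y] by simp
  have g_neg: "g (- t) = - g t" if "t \<in> Y" for t using g_scale[OF that, of "-1"] by simp
  have h_le: "h t \<le> g t" if "t \<in> Y" for t
  proof -
    have "h t \<le> p (t + - t) - g (- t)"
      using hq le[OF subspace_neg[OF Y that]] by (rule order_trans)
    then show ?thesis using g_neg[OF that] sublinear_zero[OF p] by simp
  qed
  show ?thesis
  proof (rule that[OF h])
    fix x show "h x \<le> p x"
      using order_trans[OF hq le[OF subspace_0[OF Y]]] g0 by simp
  next
    fix t assume "t \<in> Y"
    then show "h t = g t"
      using h_le[of t] h_le[of "- t"] g_neg[of t] subspace_neg[OF Y, of t] linear_neg[OF h, of t] by simp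
  qed
qed

section \<open>The canonical embedding into the bidual\<close>

lemma norming_functional:
  fixes x :: "'a::real_normed_vector"
  obtains f :: "'a dual" where "norm f \<le> 1" "blinfun_apply f x = norm x"
proof -
  have p: "sublinear (norm :: 'a \<Rightarrow> real)"
    by (rule sublinearI) (auto simp: norm_triangle_ineq)
  \<comment> \<open>the functional \<open>t x \<mapsto> t norm x\<close> on the line through \<open>x\<close>; for \<open>x = 0\<close> the coefficient \<open>t\<close> is not unique\<close>
  define g where "g y = (if x = 0 then 0 else (THE t. y = t *\<^sub>R x) * norm x)" for y
  have g: "g (t *\<^sub>R x) = t * norm x" for t
    by (cases "x = 0") (simp_all add: g_def)
  obtain h where h: "linear h" "\<And>y. h y \<le> norm y" "\<And>y. y \<in> span {x} \<Longrightarrow> h y = g y"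
  proof (rule hahn_banach[OF p subspace_span[of "{x}"], of g])
    fix s t assume "s \<in> span {x}" "t \<in> span {x}"
    then obtain a b where st: "s = a *\<^sub>R x" "t = b *\<^sub>R x" by (auto simp: span_singleton)
    show "g (s + t) = g s + g t"
      using g[of "a + b"] by (simp add: st g scaleR_add_left algebra_simps)
  next
    fix c t assume "t \<in> span {x}"
    then obtain b where t: "t = b *\<^sub>R x" by (auto simp: span_singleton)
    show "g (c *\<^sub>R t) = c * g t" using g[of "c * b"] by (simp add: t g)
  next
    fix t assume "t \<in> span {x}"
    then obtain b where t: "t = b *\<^sub>R x" by (auto simp: span_singleton)
    show "g t \<le> norm t" by (simp add: t g mult_right_mono)
  qed auto
  have bd: "\<bar>h y\<bar> \<le> norm y" for y
    using h(2)[of y] h(2)[of "- y"] linear_neg[OF h(1), of y] by simp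
  have "bounded_linear h"
    by (rule bounded_linear_intro[of h 1]) (use bd linear_add[OF h(1)] linear_scale[OF h(1)] in auto)
  then have app: "blinfun_apply (Blinfun h) = h" by (rule bounded_linear_Blinfun_apply)
  show ?thesis
  proof (rule that[of "Blinfun h"])
    show "norm (Blinfun h) \<le> 1" by (rule norm_blinfun_bound) (use bd in \<open>auto simp: app\<close>)
    show "blinfun_apply (Blinfun h) x = norm x"
      using h(3)[of "1 *\<^sub>R x"] g[of 1] by (simp add: app span_base)
  qed
qed

lemma linear_hat: "linear hat"
  by (rule linearI; rule blinfun_eqI) (simp_all add: blinfun.bilinear_simps)

lemma norm_hat: "norm (hat x) = norm x"
proof (rule antisym)
  show "norm (hat x) \<le> norm x"
  proof (rule norm_blinfun_bound)
    show "norm (blinfun_apply (hat x) f) \<le> norm x * norm f" for f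
      using norm_blinfun[of f x] by (simp add: mult.commute)
  qed simp
  obtain f :: "'a dual" where f: "norm f \<le> 1" "blinfun_apply f x = norm x"
    by (rule norming_functional)
  have "norm x = norm (blinfun_apply (hat x) f)" using f by simp
  also have "\<dots> \<le> norm (hat x) * norm f" by (rule norm_blinfun)
  also have "\<dots> \<le> norm (hat x)" using f(1) by (simp add: mult_left_le)
  finally show "norm x \<le> norm (hat x)" .
qed

lemma closed_range_hat: "closed (range (hat :: 'a::banach \<Rightarrow> 'a bidual))"
proof -
  interpret linear "hat :: 'a \<Rightarrow> 'a bidual" by (rule linear_hat)
  have "bounded_linear (hat :: 'a \<Rightarrow> 'a bidual)"
    by (rule bounded_linear_intro[of _ 1]) (simp_all add: add scale norm_hat)
  then have "complete (range (hat :: 'a \<Rightarrow> 'a bidual))"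
    by (intro complete_isometric_image[of 1]) (auto simp: norm_hat complete_UNIV)
  then show ?thesis by (rule complete_imp_closed)
qed

text \<open>
  The induction on \<open>E\<close> subtracts from \<open>T\<close> the multiple of the evaluation at \<open>e\<close> that makes
  the difference vanish already where the evaluations at the remaining points do.
\<close>

lemma functional_vanishing_on_finite_annihilator:
  fixes E :: "'a::real_normed_vector set" and T :: "'a dual \<Rightarrow> real"
  assumes "finite E" "linear T"
    and "\<And>f. (\<And>e. e \<in> E \<Longrightarrow> blinfun_apply f e = 0) \<Longrightarrow> T f = 0"
  shows "\<exists>x. \<forall>f. T f = blinfun_apply f x"
  using assms
proof (induction E arbitrary: T rule: finite_induct)
  case empty
  then show ?case by (intro exI[of _ 0]) simp
next
  case (insert e E)
  interpret T: linear T by fact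
  show ?case
  proof (cases "\<exists>f :: 'a dual. (\<forall>e'\<in>E. blinfun_apply f e' = 0) \<and> blinfun_apply f e \<noteq> 0")
    case True
    then obtain f0 :: "'a dual" where f0: "\<And>e'. e' \<in> E \<Longrightarrow> blinfun_apply f0 e' = 0" "blinfun_apply f0 e \<noteq> 0"
      by blast
    define t where "t = T f0 / blinfun_apply f0 e"
    have "\<exists>x. \<forall>f. T f - t * blinfun_apply f e = blinfun_apply f x"
    proof (rule insert.IH)
      show "linear (\<lambda>f. T f - t * blinfun_apply f e)"
        by (rule linearI) (simp_all add: T.add T.scale blinfun.bilinear_simps algebra_simps)
      fix f :: "'a dual" assume f: "\<And>e'. e' \<in> E \<Longrightarrow> blinfun_apply f e' = 0"
      define c where "c = blinfun_apply f e / blinfun_apply f0 e"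
      have "T (f - c *\<^sub>R f0) = 0"
        by (rule insert.prems(2)) (use f f0 in \<open>auto simp: blinfun.bilinear_simps c_def\<close>)
      then show "T f - t * blinfun_apply f e = 0"
        by (simp add: T.diff T.scale t_def c_def)
    qed
    then obtain x where x: "\<And>f. T f - t * blinfun_apply f e = blinfun_apply f x" by blast
    show ?thesis
    proof (intro exI allI)
      fix f show "T f = blinfun_apply f (x + t *\<^sub>R e)"
        using x[of f] by (simp add: blinfun.bilinear_simps)
    qed
  next
    case False
    then show ?thesis using insert.IH[OF insert.prems(1)] insert.prems(2) by blast
  qed
qed

text \<open>
  A form of Helly's theorem. On the annihilator of \<open>E\<close> the functional \<open>F\<close> must have norm
  larger than \<open>\<theta>\<close>: otherwise its restriction has an extension \<open>G\<close> of norm at most \<open>\<theta>\<close>, the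
  difference \<open>F - G\<close> comes from a point \<open>x\<close> of the span of \<open>E\<close>, and \<open>F\<close> is within \<open>\<theta>\<close> of
  \<open>hat x\<close>.
\<close>

lemma annihilating_functional_near_distance:
  fixes F :: "'a::real_normed_vector bidual" and E :: "'a set"
  assumes "finite E" "0 \<le> \<theta>" "\<theta> < infdist F (range hat)"
  obtains f where "norm f \<le> 1" "\<theta> < blinfun_apply F f" "\<And>e. e \<in> E \<Longrightarrow> blinfun_apply f e = 0"
proof -
  define Y where "Y = {f :: 'a dual. \<forall>e\<in>E. blinfun_apply f e = 0}"
  have Y: "subspace Y" unfolding Y_def by (rule subspaceI) (auto simp: blinfun.bilinear_simps)
  have "\<exists>f\<in>Y. \<theta> * norm f < blinfun_apply F f"
  proof (rule ccontr)
    assume "\<not> ?thesis"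
    then have dom: "\<And>f. f \<in> Y \<Longrightarrow> blinfun_apply F f \<le> \<theta> * norm f" by force
    have p: "sublinear (\<lambda>f :: 'a dual. \<theta> * norm f)"
      by (rule sublinearI)
        (use assms(2) in \<open>auto simp: norm_triangle_ineq mult_left_mono simp flip: distrib_left\<close>)
    obtain G where G: "linear G" "\<And>f. G f \<le> \<theta> * norm f" "\<And>f. f \<in> Y \<Longrightarrow> G f = blinfun_apply F f"
      by (rule hahn_banach[OF p Y, of "blinfun_apply F"]) (auto simp: blinfun.bilinear_simps dom)
    have "\<exists>x. \<forall>f. blinfun_apply F f - G f = blinfun_apply f x"
    proof (rule functional_vanishing_on_finite_annihilator[OF assms(1)])
      show "linear (\<lambda>f. blinfun_apply F f - G f)"
        by (rule linearI)
          (simp_all add: linear_add[OF G(1)] linear_scale[OF G(1)] blinfun.bilinear_simps algebra_simps)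
      show "blinfun_apply F f - G f = 0" if "\<And>e. e \<in> E \<Longrightarrow> blinfun_apply f e = 0" for f
        using G(3)[of f] that by (simp add: Y_def)
    qed
    then obtain x where x: "\<And>f. blinfun_apply F f - G f = blinfun_apply f x" by blast
    have "norm (F - hat x) \<le> \<theta>"
    proof (rule norm_blinfun_bound[OF assms(2)])
      fix f
      have "blinfun_apply (F - hat x) f = G f" using x[of f] by (simp add: blinfun.bilinear_simps)
      then show "norm (blinfun_apply (F - hat x) f) \<le> \<theta> * norm f"
        using G(2)[of f] G(2)[of "- f"] linear_neg[OF G(1), of f] by simp
    qed
    then show False using infdist_le[of "hat x" "range hat" F] assms(3) by (simp add: dist_norm)
  qed
  then obtain f where f: "f \<in> Y" "\<theta> * norm f < blinfun_apply F f" by blast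
  then have "f \<noteq> 0" by auto
  show ?thesis
  proof (rule that[of "(1 / norm f) *\<^sub>R f"])
    show "norm ((1 / norm f) *\<^sub>R f) \<le> 1" using \<open>f \<noteq> 0\<close> by simp
    show "\<theta> < blinfun_apply F ((1 / norm f) *\<^sub>R f)"
      using f(2) \<open>f \<noteq> 0\<close> by (simp add: blinfun.bilinear_simps field_simps)
    show "blinfun_apply ((1 / norm f) *\<^sub>R f) e = 0" if "e \<in> E" for e
      using f(1) that by (simp add: Y_def blinfun.bilinear_simps)
  qed
qed

section \<open>Limit functionals of a sequence\<close>

text \<open>
  These are the functionals lying pointwise between the lower and the upper limit of the
  sequence. They replace a weak-star limit, which need not exist even along a subsequence.
  Bounding \<open>h\<close> above at every \<open>x\<close> suffices, since \<open>- x\<close> gives the lower bounds, and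
  quantifying over eventual bounds \<open>c\<close> avoids infinite upper limits.
\<close>

definition limit_functionals :: "(nat \<Rightarrow> ('a::real_normed_vector) dual) \<Rightarrow> 'a dual set" where
  "limit_functionals f =
     {h. \<forall>x c. (\<forall>\<^sub>F n in sequentially. blinfun_apply (f n) x \<le> c) \<longrightarrow> blinfun_apply h x \<le> c}"

lemma limit_functionals_upper:
  "h \<in> limit_functionals f \<Longrightarrow> (\<forall>\<^sub>F n in sequentially. blinfun_apply (f n) x \<le> c)
    \<Longrightarrow> blinfun_apply h x \<le> c"
  unfolding limit_functionals_def by blast

lemma limit_functionals_lower:
  assumes "h \<in> limit_functionals f" "\<forall>\<^sub>F n in sequentially. c \<le> blinfun_apply (f n) x"
  shows "c \<le> blinfun_apply h x"
  using limit_functionals_upper[OF assms(1), of "- x" "- c"] assms(2)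
  by (simp add: blinfun.bilinear_simps)

lemma limit_functionals_norm_le:
  assumes "h \<in> limit_functionals f" "\<And>n. norm (f n) \<le> 1"
  shows "norm h \<le> 1"
proof (rule norm_blinfun_bound)
  fix x
  have "\<bar>blinfun_apply (f n) x\<bar> \<le> norm x" for n
    using norm_blinfun[of "f n" x] mult_right_mono[OF assms(2)[of n], of "norm x"] by simp
  then have "- norm x \<le> blinfun_apply (f n) x" "blinfun_apply (f n) x \<le> norm x" for n
    by (metis abs_le_iff minus_le_iff)+
  then have "blinfun_apply h x \<le> norm x" "- norm x \<le> blinfun_apply h x"
    by (auto intro!: limit_functionals_upper[OF assms(1)] limit_functionals_lower[OF assms(1)])
  then show "norm (blinfun_apply h x) \<le> 1 * norm x" by simp
qed simp

text \<open>
  The pointwise upper limit of a bounded sequence of functionals is sublinear, and by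
  Hahn--Banach it dominates a linear functional.
\<close>

lemma limit_functionals_nonempty:
  fixes f :: "nat \<Rightarrow> 'a::real_normed_vector dual"
  assumes bd: "\<And>n. norm (f n) \<le> 1"
  shows "limit_functionals f \<noteq> {}"
proof -
  define U where "U x = {c. \<forall>\<^sub>F n in sequentially. blinfun_apply (f n) x \<le> c}" for x
  define p where "p x = Inf (U x)" for x
  have fx: "\<bar>blinfun_apply (f n) x\<bar> \<le> norm x" for n x
    using norm_blinfun[of "f n" x] mult_right_mono[OF bd[of n], of "norm x"] by simp
  have bdd: "bdd_below (U x)" for x
  proof (rule bdd_belowI)
    fix c assume "c \<in> U x"
    then have "\<exists>n. blinfun_apply (f n) x \<le> c"
      unfolding U_def by (auto dest: eventually_happens)
    then show "- norm x \<le> c" using fx[of _ x] by (meson abs_le_D2 minus_le_iff order_trans)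
  qed
  have norm_U: "norm x \<in> U x" for x
    using fx by (auto simp: U_def abs_le_iff)
  have p_le: "p x \<le> c" if "c \<in> U x" for x c
    unfolding p_def by (rule cInf_lower[OF that bdd])
  have le_p: "c \<le> p x" if "\<And>d. d \<in> U x \<Longrightarrow> c \<le> d" for x c
    unfolding p_def by (rule cInf_greatest) (use that norm_U in auto)
  have "sublinear p"
  proof (rule sublinearI)
    fix x y
    have "p (x + y) \<le> c + d" if "c \<in> U x" "d \<in> U y" for c d
    proof (rule p_le)
      show "c + d \<in> U (x + y)" using that unfolding U_def mem_Collect_eq
        by eventually_elim (simp add: blinfun.bilinear_simps)
    qed
    then have "p (x + y) - d \<le> p x" if "d \<in> U y" for d
      using that by (intro le_p) (simp add: algebra_simps)
    then have "p (x + y) - p x \<le> p y"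
      by (intro le_p) (simp add: algebra_simps)
    then show "p (x + y) \<le> p x + p y" by simp
  next
    fix t :: real and x assume "0 \<le> t"
    then consider "t = 0" | "0 < t" by linarith
    then show "p (t *\<^sub>R x) \<le> t * p x"
    proof cases
      case 1
      then show ?thesis using p_le[OF norm_U, of 0] by simp
    next
      case 2
      have "p (t *\<^sub>R x) \<le> t * c" if "c \<in> U x" for c
      proof (rule p_le)
        show "t * c \<in> U (t *\<^sub>R x)" using that 2 by (simp add: U_def blinfun.bilinear_simps)
      qed
      then have "p (t *\<^sub>R x) / t \<le> p x" using 2 by (intro le_p) (simp add: field_simps)
      then show ?thesis using 2 by (simp add: field_simps)
    qed
  qed
  then obtain h where h: "linear h" "\<And>x. h x \<le> p x" using linear_below_sublinear by metis
  have hx: "\<bar>h x\<bar> \<le> norm x" for x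
    using order_trans[OF h(2) p_le[OF norm_U], of x] order_trans[OF h(2) p_le[OF norm_U], of "- x"]
      linear_neg[OF h(1), of x] by simp
  have "bounded_linear h"
    by (rule bounded_linear_intro[of h 1]) (use hx linear_add[OF h(1)] linear_scale[OF h(1)] in auto)
  then have "blinfun_apply (Blinfun h) = h" by (rule bounded_linear_Blinfun_apply)
  then have "Blinfun h \<in> limit_functionals f"
    using order_trans[OF h(2) p_le] by (simp add: limit_functionals_def U_def)
  then show ?thesis by blast
qed

lemma limit_functionals_subseq:
  assumes "strict_mono r"
  shows "limit_functionals (f \<circ> r) \<subseteq> limit_functionals f"
  unfolding limit_functionals_def using eventually_subseq[OF assms] by auto

lemma limit_functionals_shift: "limit_functionals (f \<circ> (+) k) = limit_functionals f"
  unfolding limit_functionals_def o_def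
  using eventually_sequentially_seg[of "\<lambda>n. blinfun_apply (f n) x \<le> c" k for x c]
  by (simp add: add.commute)

text \<open>
  An eventual bound \<open>f n x \<le> c\<close> defines a half-space, so it passes to convex combinations of
  the tails.
\<close>

lemma limit_functionals_convex_blocks:
  assumes g: "\<And>n. g n \<in> convex hull (f ` {n..})"
  shows "limit_functionals g \<subseteq> limit_functionals f"
proof
  fix h assume h: "h \<in> limit_functionals g"
  show "h \<in> limit_functionals f"
    unfolding limit_functionals_def
  proof (intro CollectI allI impI)
    fix x c assume "\<forall>\<^sub>F n in sequentially. blinfun_apply (f n) x \<le> c"
    then obtain N where N: "\<And>n. N \<le> n \<Longrightarrow> blinfun_apply (f n) x \<le> c"
      by (auto simp: eventually_sequentially)
    have conv: "convex {k. blinfun_apply k x \<le> c}"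
    proof (rule convexI)
      fix j k :: "'a dual" and u v :: real
      assume *: "j \<in> {k. blinfun_apply k x \<le> c}" "k \<in> {k. blinfun_apply k x \<le> c}" "0 \<le> u" "0 \<le> v" "u + v = 1"
      have "u * blinfun_apply j x + v * blinfun_apply k x \<le> u * c + v * c"
        using * by (intro add_mono mult_left_mono) auto
      also have "\<dots> = c" using *(5) by (simp flip: distrib_right)
      finally show "u *\<^sub>R j + v *\<^sub>R k \<in> {k. blinfun_apply k x \<le> c}"
        by (simp add: blinfun.bilinear_simps)
    qed
    have "blinfun_apply (g n) x \<le> c" if "N \<le> n" for n
    proof -
      have "convex hull (f ` {n..}) \<subseteq> {k. blinfun_apply k x \<le> c}"
        by (rule hull_minimal) (use N that conv in auto)
      then show ?thesis using g[of n] by blast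
    qed
    then show "blinfun_apply h x \<le> c"
      by (intro limit_functionals_upper[OF h]) (auto simp: eventually_sequentially)
  qed
qed

section \<open>Nets in convex hulls\<close>

lemma finite_net_convex_hull:
  fixes S :: "'v::real_normed_vector set"
  assumes "finite S" "0 < e"
  obtains N where "finite N" "N \<subseteq> convex hull S" "\<And>v. v \<in> convex hull S \<Longrightarrow> \<exists>y\<in>N. dist y v < e"
proof -
  have "seq_compact (convex hull S)"
    using finite_imp_compact_convex_hull[OF assms(1)] compact_imp_seq_compact by blast
  then obtain N where "finite N" "N \<subseteq> convex hull S" "convex hull S \<subseteq> (\<Union>y\<in>N. ball y e)"
    using seq_compact_imp_totally_bounded assms(2) by metis
  then show ?thesis by (intro that[of N]) (auto simp: subset_iff)
qed

lemma convex_hull_range_finite_prefix: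
  fixes f :: "nat \<Rightarrow> 'v::real_vector"
  assumes "v \<in> convex hull (insert z (range f))"
  obtains m where "v \<in> convex hull (insert z (f ` {..<m}))"
proof -
  define C where "C m = convex hull (insert z (f ` {..<m}))" for m
  have mono: "C m \<subseteq> C n" if "m \<le> n" for m n
    unfolding C_def by (rule hull_mono) (use that in auto)
  have "convex (\<Union>m. C m)"
  proof (rule convexI)
    fix x y and s t :: real
    assume "x \<in> (\<Union>m. C m)" "y \<in> (\<Union>m. C m)" and st: "0 \<le> s" "0 \<le> t" "s + t = 1"
    then obtain m n where "x \<in> C m" "y \<in> C n" by blast
    then have "x \<in> C (max m n)" "y \<in> C (max m n)"
      using mono[of m "max m n"] mono[of n "max m n"] by auto
    moreover have "convex (C (max m n))" by (simp add: C_def)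
    ultimately have "s *\<^sub>R x + t *\<^sub>R y \<in> C (max m n)" using st by (intro convexD) auto
    then show "s *\<^sub>R x + t *\<^sub>R y \<in> (\<Union>m. C m)" by blast
  qed
  moreover have "insert z (range f) \<subseteq> (\<Union>m. C m)"
  proof
    fix x assume "x \<in> insert z (range f)"
    then consider "x = z" | n where "x = f n" by blast
    then show "x \<in> (\<Union>m. C m)"
    proof cases
      case 1
      then have "x \<in> C 0" by (simp add: C_def)
      then show ?thesis by blast
    next
      case 2
      then have "x \<in> C (Suc n)" unfolding C_def by (intro hull_inc) auto
      then show ?thesis by blast
    qed
  qed
  ultimately have "convex hull (insert z (range f)) \<subseteq> (\<Union>m. C m)" by (intro hull_minimal)
  then show ?thesis using assms that by (auto simp: C_def)
qed

text \<open>
  The slopes of a convex function increase along a segment: \<open>X\<close>, \<open>W\<close> and \<open>Z\<close> lie on a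
  segment in this order at distances proportional to \<open>s\<close> and \<open>t\<close>.
\<close>

lemma convex_on_increment:
  fixes \<phi> :: "'v::real_vector \<Rightarrow> real"
  assumes "convex_on S \<phi>" "X \<in> S" "Z \<in> S" "0 < s" "0 < t"
    and W: "W = (t / (s + t)) *\<^sub>R X + (s / (s + t)) *\<^sub>R Z"
    and incr: "\<phi> X + s * \<alpha> \<le> \<phi> W"
  shows "\<phi> W + t * \<alpha> \<le> \<phi> Z"
proof -
  have "\<phi> W \<le> (t / (s + t)) * \<phi> X + (s / (s + t)) * \<phi> Z"
  proof -
    have "1 - s / (s + t) = t / (s + t)" using assms(4,5) by (simp add: field_simps)
    then show ?thesis
      using convex_onD[OF assms(1), of "s / (s + t)" X Z] assms(2-5) by (simp add: W)
  qed
  also have "\<dots> = (t * \<phi> X + s * \<phi> Z) / (s + t)" by (simp add: add_divide_distrib)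
  finally have "(s + t) * \<phi> W \<le> t * \<phi> X + s * \<phi> Z" using assms(4,5) by (simp add: field_simps)
  moreover have "t * (\<phi> X + s * \<alpha>) \<le> t * \<phi> W" using incr assms(5) by simp
  ultimately have "s * (\<phi> W + t * \<alpha>) \<le> s * \<phi> Z" by (simp add: algebra_simps)
  then show ?thesis using assms(4) by simp
qed

section \<open>Convex functions with subgradients in the predual\<close>

text \<open>
  The situation near a point of the open set after translation and scaling. Functionals \<open>v\<close>
  and \<open>h\<close> of norm at most 1 are going to be combined as \<open>v - c h\<close> with \<open>0 \<le> c \<le> 1\<close>, and this
  is the reason for the radius 2.
\<close>

locale lipschitz_with_subgradients =
  fixes \<phi> :: "('a::banach) dual \<Rightarrow> real" and K :: real
  assumes convex: "convex_on (cball 0 2) \<phi>"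
    and K_pos: "0 < K"
    and lipschitz: "\<And>y z. y \<in> cball 0 2 \<Longrightarrow> z \<in> cball 0 2 \<Longrightarrow> \<phi> y \<le> \<phi> z + K * norm (y - z)"
    and subgradient_exists: "\<And>y. y \<in> cball 0 2 \<Longrightarrow>
      \<exists>x. \<forall>z\<in>cball 0 2. blinfun_apply z x - blinfun_apply y x \<le> \<phi> z - \<phi> y"
begin

definition subgradient :: "'a dual \<Rightarrow> 'a" where
  "subgradient y = (SOME x. \<forall>z\<in>cball 0 2. blinfun_apply z x - blinfun_apply y x \<le> \<phi> z - \<phi> y)"

lemma subgradient_le:
  assumes "y \<in> cball 0 2" "z \<in> cball 0 2"
  shows "\<phi> y + blinfun_apply (z - y) (subgradient y) \<le> \<phi> z"
  using someI_ex[OF subgradient_exists[OF assms(1)]] assms(2)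
  by (fastforce simp: subgradient_def blinfun.bilinear_simps)

lemma diff_in_domain:
  assumes "norm (v :: 'a dual) \<le> 1" "norm (h :: 'a dual) \<le> 1" "0 \<le> c" "c \<le> 1"
  shows "v - c *\<^sub>R h \<in> cball 0 2"
proof -
  have "norm (v - c *\<^sub>R h) \<le> norm v + c * norm h"
    using norm_triangle_ineq4[of v "c *\<^sub>R h"] assms(3) by simp
  also have "\<dots> \<le> 1 + 1 * 1" using assms by (intro add_mono mult_mono) auto
  finally show ?thesis by simp
qed

text \<open>
  If \<open>h\<close> vanishes at the subgradient \<open>x\<close> of \<open>\<phi>\<close> at \<open>y\<close>, then the subgradient inequality at
  \<open>y - c h\<close> reads \<open>\<phi> y \<le> \<phi> (y - c h)\<close>. The Lipschitz condition carries this from \<open>Q\<close> to its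
  closure.
\<close>

lemma le_after_subtracting_limit_functional:
  assumes f: "\<And>n. norm (f n) \<le> 1"
    and Q: "Q \<subseteq> cball 0 1" "\<And>y. y \<in> Q \<Longrightarrow> \<forall>\<^sub>F n in sequentially. blinfun_apply (f n) (subgradient y) = 0"
    and v: "v \<in> closure Q" and h: "h \<in> limit_functionals f" and c: "0 \<le> c" "c \<le> 1"
  shows "\<phi> v \<le> \<phi> (v - c *\<^sub>R h)"
proof (rule field_le_epsilon)
  fix e :: real assume "0 < e"
  then obtain y where y: "y \<in> Q" "dist y v < e / (2 * K)"
    using v K_pos by (metis closure_approachable divide_pos_pos mult_pos_pos zero_less_numeral)
  have nh: "norm h \<le> 1" using limit_functionals_norm_le[OF h f] .
  have nv: "norm v \<le> 1" using v closure_minimal[OF Q(1) closed_cball] by auto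
  have ny: "norm y \<le> 1" using y Q by auto
  have "blinfun_apply h (subgradient y) = 0"
  proof (rule antisym)
    show "blinfun_apply h (subgradient y) \<le> 0"
      by (rule limit_functionals_upper[OF h]) (use Q(2)[OF y(1)] in eventually_elim, simp)
    show "0 \<le> blinfun_apply h (subgradient y)"
      by (rule limit_functionals_lower[OF h]) (use Q(2)[OF y(1)] in eventually_elim, simp)
  qed
  then have "\<phi> y \<le> \<phi> (y - c *\<^sub>R h)"
    using subgradient_le[of y "y - c *\<^sub>R h"] diff_in_domain[OF ny nh c] ny
    by (simp add: blinfun.bilinear_simps)
  moreover have "\<phi> v \<le> \<phi> y + K * norm (v - y)" using nv ny by (intro lipschitz) auto
  moreover have "\<phi> (y - c *\<^sub>R h) \<le> \<phi> (v - c *\<^sub>R h) + K * norm (y - v)"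
    using lipschitz[OF diff_in_domain[OF ny nh c] diff_in_domain[OF nv nh c]] by simp
  moreover have "K * norm (y - v) \<le> e / 2"
    using y(2) K_pos by (simp add: dist_norm field_simps)
  ultimately show "\<phi> v \<le> \<phi> (v - c *\<^sub>R h) + e" by (simp add: norm_minus_commute)
qed

text \<open>
  The term \<open>f n\<close> is chosen to annihilate the subgradients at the points of finite nets in
  the hulls of 0 and the earlier terms, the nets becoming finer; only finitely many
  conditions are imposed at each step, as Helly's theorem requires, but together the nets
  are dense in the hull of the whole sequence.
\<close>

lemma sequence_vanishing_on_subgradients:
  assumes "0 \<le> \<theta>" "\<theta> < infdist F (range hat)"
  obtains f Q where "\<And>n. norm (f n) \<le> 1" "\<And>n. \<theta> < blinfun_apply F (f n)"
    "countable Q" "Q \<subseteq> convex hull (insert 0 (range f))" "convex hull (insert 0 (range f)) \<subseteq> closure Q"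
    "\<And>y. y \<in> Q \<Longrightarrow> \<forall>\<^sub>F n in sequentially. blinfun_apply (f n) (subgradient y) = 0"
proof -
  have ex_net: "\<exists>N. finite S \<longrightarrow> finite N \<and> N \<subseteq> convex hull S \<and>
      (\<forall>v\<in>convex hull S. \<exists>y\<in>N. dist y v < 1 / real (Suc m))" for S :: "'a dual set" and m :: nat
  proof (cases "finite S")
    case True
    obtain N where "finite N" "N \<subseteq> convex hull S"
      "\<And>v. v \<in> convex hull S \<Longrightarrow> \<exists>y\<in>N. dist y v < 1 / real (Suc m)"
      by (rule finite_net_convex_hull[OF True, of "1 / real (Suc m)"]) auto
    then show ?thesis by blast
  qed simp
  define net where "net S m = (SOME N. finite S \<longrightarrow> finite N \<and> N \<subseteq> convex hull S \<and>
      (\<forall>v\<in>convex hull S. \<exists>y\<in>N. dist y v < 1 / real (Suc m)))" for S :: "'a dual set" and m :: nat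
  have net: "finite (net S m)" "net S m \<subseteq> convex hull S"
      "\<And>v. v \<in> convex hull S \<Longrightarrow> \<exists>y\<in>net S m. dist y v < 1 / real (Suc m)"
    if "finite S" for S m
    using someI_ex[OF ex_net[of S m]] that unfolding net_def by simp_all
  define N where "N f m = net (insert 0 (f ` {..<m})) m" for f :: "nat \<Rightarrow> 'a dual" and m
  have "\<exists>f. \<forall>n. norm (f n) \<le> 1 \<and> \<theta> < blinfun_apply F (f n) \<and>
      (\<forall>m\<le>n. \<forall>y\<in>N f m. blinfun_apply (f n) (subgradient y) = 0)"
  proof (rule dependent_wellorder_choice)
    fix r and f g :: "nat \<Rightarrow> 'a dual" and n :: nat
    assume "\<And>k. k < n \<Longrightarrow> f k = g k"
    then have "N f m = N g m" if "m \<le> n" for m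
      using that unfolding N_def by (intro arg_cong2[where f = net] arg_cong2[where f = insert] image_cong) auto
    then show "(norm r \<le> 1 \<and> \<theta> < blinfun_apply F r \<and> (\<forall>m\<le>n. \<forall>y\<in>N f m. blinfun_apply r (subgradient y) = 0))
      = (norm r \<le> 1 \<and> \<theta> < blinfun_apply F r \<and> (\<forall>m\<le>n. \<forall>y\<in>N g m. blinfun_apply r (subgradient y) = 0))"
      by simp
  next
    fix n :: nat and f :: "nat \<Rightarrow> 'a dual"
    have "finite (subgradient ` (\<Union>m\<le>n. N f m))" by (simp add: N_def net(1))
    from annihilating_functional_near_distance[OF this assms]
    show "\<exists>r. norm r \<le> 1 \<and> \<theta> < blinfun_apply F r \<and> (\<forall>m\<le>n. \<forall>y\<in>N f m. blinfun_apply r (subgradient y) = 0)"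
      by (metis UN_I atMost_iff imageI)
  qed
  then obtain f where f: "\<And>n. norm (f n) \<le> 1" "\<And>n. \<theta> < blinfun_apply F (f n)"
    "\<And>n m y. m \<le> n \<Longrightarrow> y \<in> N f m \<Longrightarrow> blinfun_apply (f n) (subgradient y) = 0" by blast
  show ?thesis
  proof (rule that[of f "\<Union>m. N f m"])
    show "countable (\<Union>m. N f m)" by (simp add: N_def net(1) countable_finite)
    show "(\<Union>m. N f m) \<subseteq> convex hull (insert 0 (range f))"
    proof (rule UN_least)
      fix m
      have "N f m \<subseteq> convex hull (insert 0 (f ` {..<m}))" unfolding N_def by (rule net(2)) simp
      also have "\<dots> \<subseteq> convex hull (insert 0 (range f))" by (rule hull_mono) auto
      finally show "N f m \<subseteq> convex hull (insert 0 (range f))" .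
    qed
    show "convex hull (insert 0 (range f)) \<subseteq> closure (\<Union>m. N f m)"
    proof
      fix v assume "v \<in> convex hull (insert 0 (range f))"
      then obtain m where m: "v \<in> convex hull (insert 0 (f ` {..<m}))"
        by (rule convex_hull_range_finite_prefix)
      show "v \<in> closure (\<Union>m. N f m)"
        unfolding closure_approachable
      proof (intro allI impI)
        fix e :: real assume "0 < e"
        then obtain k where k: "1 / real (Suc k) < e" using nat_approx_posE by blast
        have "v \<in> convex hull (insert 0 (f ` {..<max m k}))"
          using m hull_mono[of "insert 0 (f ` {..<m})" "insert 0 (f ` {..<max m k})" convex] by force
        then obtain y where y: "y \<in> N f (max m k)" "dist y v < 1 / real (Suc (max m k))"
          unfolding N_def using net(3) by (metis finite_imageI finite_insert finite_lessThan)
        have "1 / real (Suc (max m k)) \<le> 1 / real (Suc k)" by (intro divide_left_mono) auto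
        then show "\<exists>y\<in>\<Union>m. N f m. dist y v < e" using y k by force
      qed
    qed
    show "\<forall>\<^sub>F n in sequentially. blinfun_apply (f n) (subgradient y) = 0" if "y \<in> (\<Union>m. N f m)" for y
      using that f(3) by (auto simp: eventually_sequentially)
  qed (use f in auto)
qed

section \<open>Stabilising the limit functionals along a subsequence\<close>

text \<open>
  Pryce's argument. The number \<open>Inf B\<close> below is the infimum, over all subsequences, of the
  supremum of \<open>\<phi> (v - c h)\<close> over limit functionals \<open>h\<close>; let \<open>r\<close> and \<open>h\<close> nearly attain it.
  Let \<open>x\<close> be the subgradient at \<open>v - c h\<close>. Since \<open>h x\<close> is at least the lower limit of the
  values \<open>f (r n) x\<close>, there is a further subsequence along which these values stay below
  \<open>h x + e / 3\<close>. All its limit functionals \<open>k\<close> satisfy \<open>k x \<le> h x + e / 3\<close>, and the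
  subgradient inequality bounds \<open>\<phi> (v - c k)\<close> from below by almost \<open>Inf B\<close>.
\<close>

lemma subseq_small_oscillation:
  fixes f :: "nat \<Rightarrow> 'a dual"
  assumes f: "\<And>n. norm (f n) \<le> 1" and v: "norm v \<le> 1" and c: "0 \<le> c" "c \<le> 1" and e: "0 < e"
  obtains r where "strict_mono r"
    "\<And>h h'. h \<in> limit_functionals (f \<circ> r) \<Longrightarrow> h' \<in> limit_functionals (f \<circ> r)
       \<Longrightarrow> \<phi> (v - c *\<^sub>R h) \<le> \<phi> (v - c *\<^sub>R h') + e"
proof -
  define L where "L r = limit_functionals (f \<circ> r)" for r
  have nL: "norm h \<le> 1" if "h \<in> L r" for h r
    using limit_functionals_norm_le[of h "f \<circ> r"] that f by (simp add: L_def)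
  have neL: "L r \<noteq> {}" for r unfolding L_def by (rule limit_functionals_nonempty) (simp add: f)
  note dom = diff_in_domain[OF v nL c]
  define B where "B = {s. \<exists>r. strict_mono r \<and> (\<forall>h\<in>L r. \<phi> (v - c *\<^sub>R h) \<le> s)}"
  have near_0: "\<phi> 0 - 2 * K \<le> \<phi> y" "\<phi> y \<le> \<phi> 0 + 2 * K" if "y \<in> cball 0 2" for y
  proof -
    have "K * norm y \<le> K * 2" using that K_pos by simp
    then show "\<phi> 0 - 2 * K \<le> \<phi> y" "\<phi> y \<le> \<phi> 0 + 2 * K"
      using lipschitz[of 0 y] lipschitz[of y 0] that by auto
  qed
  have "\<phi> 0 + 2 * K \<in> B" 
    unfolding B_def using near_0(2)[OF dom] strict_mono_id by blast
  then have neB: "B \<noteq> {}" by blast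
  have bddB: "bdd_below B"
  proof (rule bdd_belowI)
    fix s assume "s \<in> B"
    then obtain r where "\<And>h. h \<in> L r \<Longrightarrow> \<phi> (v - c *\<^sub>R h) \<le> s" by (auto simp: B_def)
    then show "\<phi> 0 - 2 * K \<le> s" using neL[of r] near_0(1)[OF dom] by fastforce
  qed
  obtain s where "s \<in> B" "s < Inf B + e / 3" using cInf_lessD[OF neB, of "Inf B + e / 3"] e by auto
  then obtain r where r: "strict_mono r" "\<And>h. h \<in> L r \<Longrightarrow> \<phi> (v - c *\<^sub>R h) < Inf B + e / 3"
    by (force simp: B_def)
  \<comment> \<open>the supremum along \<open>r\<close> cannot drop below \<open>Inf B\<close>, so some limit functional nearly attains it\<close>
  have "Inf B - e / 3 \<notin> B" using cInf_lower[OF _ bddB, of "Inf B - e / 3"] e by auto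
  then obtain h where h: "h \<in> L r" "Inf B - e / 3 < \<phi> (v - c *\<^sub>R h)"
    using r(1) by (force simp: B_def)
  define x where "x = subgradient (v - c *\<^sub>R h)"
  have "infinite {n. blinfun_apply ((f \<circ> r) n) x < blinfun_apply h x + e / 3}"
  proof
    assume "finite {n. blinfun_apply ((f \<circ> r) n) x < blinfun_apply h x + e / 3}"
    then have "\<forall>\<^sub>F n in sequentially. blinfun_apply h x + e / 3 \<le> blinfun_apply ((f \<circ> r) n) x"
      unfolding cofinite_eq_sequentially[symmetric] eventually_cofinite by (simp add: not_le)
    then have "blinfun_apply h x + e / 3 \<le> blinfun_apply h x"
      using limit_functionals_lower h(1) unfolding L_def by blast
    then show False using e by simp
  qed
  then obtain r' :: "nat \<Rightarrow> nat" where r': "strict_mono r'"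
    "\<And>n. blinfun_apply ((f \<circ> r) (r' n)) x < blinfun_apply h x + e / 3"
    using infinite_enumerate by blast
  have sub: "L (r \<circ> r') \<subseteq> L r"
    using limit_functionals_subseq[OF r'(1), of "f \<circ> r"] by (simp add: L_def comp_assoc)
  have lower: "Inf B - 2 * e / 3 \<le> \<phi> (v - c *\<^sub>R k)" if k: "k \<in> L (r \<circ> r')" for k
  proof -
    have "blinfun_apply k x \<le> blinfun_apply h x + e / 3"
      by (rule limit_functionals_upper[OF k[unfolded L_def]]) (use r'(2) in \<open>auto simp: less_imp_le\<close>)
    then have "c * (blinfun_apply k x - blinfun_apply h x) \<le> c * (e / 3)" using c by (intro mult_left_mono) auto
    also have "\<dots> \<le> 1 * (e / 3)" using c e by (intro mult_right_mono) auto
    finally have "c * (blinfun_apply k x - blinfun_apply h x) \<le> e / 3" by simp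
    moreover have "\<phi> (v - c *\<^sub>R h) + blinfun_apply ((v - c *\<^sub>R k) - (v - c *\<^sub>R h)) x \<le> \<phi> (v - c *\<^sub>R k)"
      unfolding x_def using subgradient_le[OF dom[OF h(1)] dom[OF k]] .
    ultimately show ?thesis using h(2) by (simp add: blinfun.bilinear_simps algebra_simps)
  qed
  show ?thesis
  proof (rule that[of "r \<circ> r'"])
    show "strict_mono (r \<circ> r')" using r(1) r'(1) by (rule strict_mono_o)
    fix k k' assume "k \<in> limit_functionals (f \<circ> (r \<circ> r'))" "k' \<in> limit_functionals (f \<circ> (r \<circ> r'))"
    then show "\<phi> (v - c *\<^sub>R k) \<le> \<phi> (v - c *\<^sub>R k') + e"
      using r(2)[of k] lower[of k'] sub by (force simp: L_def)
  qed
qed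

text \<open>
  Oscillation below a given bound survives passing to subsequences, so a diagonal
  subsequence achieves every bound at every point of \<open>Q\<close> and every coefficient \<open>b n\<close>; the
  Lipschitz condition extends the result to the closure of \<open>Q\<close>.
\<close>

lemma subseq_no_oscillation:
  fixes f :: "nat \<Rightarrow> 'a dual" and b :: "nat \<Rightarrow> real"
  assumes f: "\<And>n. norm (f n) \<le> 1" and Q: "countable Q" "Q \<subseteq> cball 0 1"
    and b: "\<And>n. 0 \<le> b n" "\<And>n. b n \<le> 1"
  obtains r where "strict_mono r"
    "\<And>v n h h'. v \<in> closure Q \<Longrightarrow> h \<in> limit_functionals (f \<circ> r) \<Longrightarrow> h' \<in> limit_functionals (f \<circ> r)
       \<Longrightarrow> \<phi> (v - b n *\<^sub>R h) = \<phi> (v - b n *\<^sub>R h')"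
proof -
  define small where "small v n m s \<longleftrightarrow> (\<forall>h\<in>limit_functionals (f \<circ> s). \<forall>h'\<in>limit_functionals (f \<circ> s).
    \<phi> (v - b n *\<^sub>R h) \<le> \<phi> (v - b n *\<^sub>R h') + 1 / real (Suc m))" for v n m and s :: "nat \<Rightarrow> nat"
  define q where "q = from_nat_into (insert 0 Q)"
  have qQ: "norm (q i) \<le> 1" for i
    using from_nat_into[of "insert 0 Q" i] Q(2) by (auto simp: q_def)
  have q_surj: "\<exists>i. q i = v" if "v \<in> Q" for v
    using from_nat_into_surj[of "insert 0 Q" v] Q(1) that by (auto simp: q_def)
  define P where "P k s = (case prod_decode k of (i, j) \<Rightarrow>
    case prod_decode j of (n, m) \<Rightarrow> small (q i) n m s)" for k and s :: "nat \<Rightarrow> nat"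
  have small_subseq: "small v n m (s \<circ> r)" if "strict_mono r" "small v n m s" for v n m r s
    using that(2) limit_functionals_subseq[OF that(1), of "f \<circ> s"]
    unfolding small_def by (auto simp: comp_assoc subset_iff)
  interpret subseqs P
  proof
    fix k and s :: "nat \<Rightarrow> nat" assume "strict_mono s"
    obtain i j n m where k: "prod_decode k = (i, j)" "prod_decode j = (n, m)" by (metis surj_pair)
    obtain r where "strict_mono r"
      "\<And>h h'. h \<in> limit_functionals ((f \<circ> s) \<circ> r) \<Longrightarrow> h' \<in> limit_functionals ((f \<circ> s) \<circ> r)
       \<Longrightarrow> \<phi> (q i - b n *\<^sub>R h) \<le> \<phi> (q i - b n *\<^sub>R h') + 1 / real (Suc m)"
      by (rule subseq_small_oscillation[of "f \<circ> s" "q i" "b n" "1 / real (Suc m)"]) (use f qQ b in auto)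
    then show "\<exists>r'. strict_mono r' \<and> P k (s \<circ> r')"
      by (auto simp: P_def k small_def comp_assoc)
  qed
  have "P k (diagseq \<circ> (+) (Suc k))" for k
    by (rule diagseq_holds) (auto simp: P_def small_subseq split: prod.splits)
  then have "small (q i) n m (diagseq \<circ> (+) (Suc (prod_encode (i, prod_encode (n, m)))))" for i n m
    unfolding P_def by (metis case_prod_conv prod_encode_inverse)
  then have small: "small (q i) n m diagseq" for i n m
    using limit_functionals_shift[of "f \<circ> diagseq"] by (simp add: small_def flip: comp_assoc)
  define L where "L = limit_functionals (f \<circ> diagseq)"
  have nL: "norm h \<le> 1" if "h \<in> L" for h
    using limit_functionals_norm_le[of h "f \<circ> diagseq"] that f by (simp add: L_def)
  have le: "\<phi> (v - b n *\<^sub>R h) \<le> \<phi> (v - b n *\<^sub>R h')" if v: "v \<in> closure Q" and h: "h \<in> L" "h' \<in> L" for v n h h'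
  proof (rule field_le_epsilon)
    fix e :: real assume e: "0 < e"
    obtain m where m: "1 / real (Suc m) < e / 3" using nat_approx_posE[of "e / 3"] e by auto
    obtain y where y: "y \<in> Q" "dist y v < e / (3 * K)"
      using v K_pos e by (metis closure_approachable divide_pos_pos mult_pos_pos zero_less_numeral)
    then obtain i where i: "q i = y" using q_surj by blast
    have nv: "norm v \<le> 1" using v closure_minimal[OF Q(2) closed_cball] by auto
    have ny: "norm y \<le> 1" using y Q by auto
    note D = diff_in_domain[OF _ nL b(1)[of n] b(2)[of n]]
    have "\<phi> (v - b n *\<^sub>R h) \<le> \<phi> (y - b n *\<^sub>R h) + K * norm (v - y)"
      using lipschitz[OF D[OF nv h(1)] D[OF ny h(1)]] by simp
    moreover have "\<phi> (y - b n *\<^sub>R h') \<le> \<phi> (v - b n *\<^sub>R h') + K * norm (v - y)"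
      using lipschitz[OF D[OF ny h(2)] D[OF nv h(2)]] by (simp add: norm_minus_commute)
    moreover have "\<phi> (y - b n *\<^sub>R h) \<le> \<phi> (y - b n *\<^sub>R h') + 1 / real (Suc m)"
      using small[of i n m] h by (simp add: small_def i L_def)
    moreover have "K * norm (v - y) \<le> e / 3"
      using y(2) K_pos by (simp add: dist_norm norm_minus_commute field_simps)
    ultimately show "\<phi> (v - b n *\<^sub>R h) \<le> \<phi> (v - b n *\<^sub>R h') + e" using m by linarith
  qed
  show ?thesis
    by (rule that[OF subseq_diagseq]) (use le in \<open>auto simp: L_def intro: antisym\<close>)
qed

end

section \<open>Rapidly decreasing weights\<close>

text \<open>
  The weights sum to 1, and \<open>remainder n\<close> is the sum of the weights from index \<open>n\<close> on. The
  factorials make \<open>remainder (Suc n)\<close> negligible compared with \<open>weight n\<close>: the effect of one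
  term of the series below must dominate the effect of all later terms together.
\<close>

definition remainder :: "nat \<Rightarrow> real" where
  "remainder n = 1 / fact (Suc n)"

definition weight :: "nat \<Rightarrow> real" where
  "weight n = remainder n - remainder (Suc n)"

lemma remainder_pos: "0 < remainder n"
  by (simp add: remainder_def)

lemma remainder_Suc: "remainder n = real (n + 2) * remainder (Suc n)"
proof -
  have "fact (Suc (Suc n)) = real (n + 2) * fact (Suc n)" by simp
  then show ?thesis unfolding remainder_def by (simp del: fact_Suc)
qed

lemma weight_eq: "weight n = real (n + 1) * remainder (Suc n)"
  unfolding weight_def remainder_Suc[of n] by (simp add: algebra_simps)

lemma weight_pos: "0 < weight n"
  by (simp add: weight_eq remainder_pos)

lemma remainder_le_1: "remainder n \<le> 1"
  using fact_ge_1[of "Suc n", where 'a = real] by (simp add: remainder_def del: fact_Suc)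

lemma remainder_0: "remainder 0 = 1"
  by (simp add: remainder_def)

lemma remainder_tendsto_0: "remainder \<longlonglongrightarrow> 0"
proof (rule tendsto_sandwich[OF _ _ tendsto_const LIMSEQ_inverse_real_of_nat])
  show "\<forall>\<^sub>F n in sequentially. remainder n \<le> inverse (real (Suc n))"
  proof (rule always_eventually, rule allI)
    fix n
    have "real (Suc n) \<le> real (fact (Suc n))" by (metis fact_ge_self of_nat_le_iff)
    then show "remainder n \<le> inverse (real (Suc n))"
      by (simp add: remainder_def inverse_eq_divide divide_left_mono del: fact_Suc of_nat_Suc)
  qed
qed (auto simp: remainder_pos less_imp_le intro: always_eventually)

text \<open>
  Since the weights below \<open>n\<close> and \<open>remainder n\<close> add up to 1, this is a convex combination;
  it is written with a free last point \<open>z\<close> so that the induction can split \<open>z\<close> into the next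
  term and the rest.
\<close>

lemma weighted_sum_in_hull:
  fixes g :: "nat \<Rightarrow> 'v::real_vector"
  assumes "convex H" "\<And>i. i < n \<Longrightarrow> g i \<in> H" "z \<in> H"
  shows "(\<Sum>i<n. weight i *\<^sub>R g i) + remainder n *\<^sub>R z \<in> H"
  using assms(2,3)
proof (induction n arbitrary: z)
  case 0
  then show ?case by (simp add: remainder_0)
next
  case (Suc n)
  define z' where "z' = (weight n / remainder n) *\<^sub>R g n + (remainder (Suc n) / remainder n) *\<^sub>R z"
  have "z' \<in> H" unfolding z'_def
  proof (rule convexD[OF assms(1)])
    show "weight n / remainder n + remainder (Suc n) / remainder n = 1"
      using remainder_pos[of n] by (simp add: weight_def flip: add_divide_distrib)
  qed (use Suc.prems weight_pos remainder_pos in \<open>auto simp: less_imp_le intro!: divide_nonneg_pos\<close>)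
  then have "(\<Sum>i<n. weight i *\<^sub>R g i) + remainder n *\<^sub>R z' \<in> H"
    using Suc by simp
  moreover have "remainder n *\<^sub>R z' = weight n *\<^sub>R g n + remainder (Suc n) *\<^sub>R z"
    using remainder_pos[of n] by (simp add: z'_def scaleR_add_right)
  ultimately show ?case by (simp add: add.assoc)
qed

lemma near_minimizer:
  fixes \<psi> :: "'b \<Rightarrow> real"
  assumes "C \<noteq> {}" "bdd_below (\<psi> ` C)" "0 < e"
  obtains r where "r \<in> C" "\<And>k. k \<in> C \<Longrightarrow> \<psi> r \<le> \<psi> k + e"
proof -
  obtain r where r: "r \<in> C" "\<psi> r < (INF k\<in>C. \<psi> k) + e"
    using cInf_lessD[of "\<psi> ` C" "(INF k\<in>C. \<psi> k) + e"] assms by auto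
  show ?thesis
    by (rule that[OF r(1)]) (use r(2) cINF_lower[OF assms(2)] in force)
qed

lemma weighted_sum_tail:
  fixes g :: "nat \<Rightarrow> 'v::banach"
  assumes g: "\<And>n. norm (g n) \<le> 1"
  obtains U where "(\<lambda>n. \<Sum>i<n. weight i *\<^sub>R g i) \<longlonglongrightarrow> U"
    "\<And>n. norm (U - (\<Sum>i<n. weight i *\<^sub>R g i)) \<le> remainder n"
proof -
  define u where "u n = (\<Sum>i<n. weight i *\<^sub>R g i)" for n
  have weight_le: "norm (weight i *\<^sub>R g i) \<le> weight i" for i
    using mult_left_mono[OF g[of i] less_imp_le[OF weight_pos[of i]]] weight_pos[of i] by simp
  have "summable weight"
    unfolding weight_def using telescope_summable'[OF remainder_tendsto_0] .
  then have "summable (\<lambda>i. weight i *\<^sub>R g i)"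
    by (rule summable_comparison_test') (rule weight_le)
  then have lim: "u \<longlonglongrightarrow> (\<Sum>i. weight i *\<^sub>R g i)" unfolding u_def by (rule summable_LIMSEQ)
  have "norm (u (n + k) - u n) \<le> remainder n - remainder (n + k)" for n k
  proof (induction k)
    case (Suc k)
    have "u (n + Suc k) - u n = (u (n + k) - u n) + weight (n + k) *\<^sub>R g (n + k)" by (simp add: u_def)
    also have "norm \<dots> \<le> (remainder n - remainder (n + k)) + weight (n + k)"
      by (rule norm_triangle_mono[OF Suc weight_le])
    finally show ?case by (simp add: weight_def)
  qed simp
  then have tail: "norm (u (n + k) - u n) \<le> remainder n" for n k
    using remainder_pos[of "n + k"] by (smt (verit))
  have "norm ((\<Sum>i. weight i *\<^sub>R g i) - u n) \<le> remainder n" for n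
  proof (rule tendsto_upperbound)
    show "(\<lambda>k. norm (u (n + k) - u n)) \<longlonglongrightarrow> norm ((\<Sum>i. weight i *\<^sub>R g i) - u n)"
      using LIMSEQ_ignore_initial_segment[OF lim, of n]
      by (intro tendsto_intros) (simp add: add.commute)
  qed (auto simp: tail)
  then show ?thesis using that lim unfolding u_def[abs_def] by blast
qed

section \<open>The James sequence\<close>

context lipschitz_with_subgradients
begin

text \<open>
  James's choice. The term \<open>g n\<close> nearly minimises the next value of \<open>\<phi>\<close> among the convex
  combinations of the tail, given the earlier terms. Functionals \<open>k\<close> of later tails are
  competitors as well, and this turns a lower bound for one step into lower bounds for all
  the following ones.
\<close>

lemma near_minimizing_blocks:
  fixes f :: "nat \<Rightarrow> 'a dual"
  assumes f: "\<And>n. norm (f n) \<le> 1" and h: "norm h \<le> 1" and \<epsilon>: "\<And>n. 0 < \<epsilon> n"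
  obtains g where "\<And>n. g n \<in> convex hull (f ` {n..})"
    "\<And>n k. k \<in> convex hull (f ` {n..}) \<Longrightarrow>
       \<phi> ((\<Sum>i<Suc n. weight i *\<^sub>R g i) - (1 - remainder (Suc n)) *\<^sub>R h)
       \<le> \<phi> ((\<Sum>i<n. weight i *\<^sub>R g i) + weight n *\<^sub>R k - (1 - remainder (Suc n)) *\<^sub>R h) + \<epsilon> n"
proof -
  define C where "C n = convex hull (f ` {n..})" for n
  define \<psi> where "\<psi> g n k = \<phi> ((\<Sum>i<n. weight i *\<^sub>R g i) + weight n *\<^sub>R k - (1 - remainder (Suc n)) *\<^sub>R h)"
    for g n and k :: "'a dual"
  have C1: "norm k \<le> 1" if "k \<in> C n" for k n
  proof -
    have "C n \<subseteq> cball 0 1" unfolding C_def by (rule hull_minimal) (auto simp: f)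
    then show ?thesis using that by auto
  qed
  have "\<exists>g. \<forall>n. g n \<in> C n \<and> (\<forall>k\<in>C n. \<psi> g n (g n) \<le> \<psi> g n k + \<epsilon> n)"
  proof (rule dependent_wellorder_choice)
    fix r and g g' :: "nat \<Rightarrow> 'a dual" and n :: nat
    assume "\<And>k. k < n \<Longrightarrow> g k = g' k"
    then have "\<psi> g n k = \<psi> g' n k" for k by (simp add: \<psi>_def)
    then show "(r \<in> C n \<and> (\<forall>k\<in>C n. \<psi> g n r \<le> \<psi> g n k + \<epsilon> n))
      = (r \<in> C n \<and> (\<forall>k\<in>C n. \<psi> g' n r \<le> \<psi> g' n k + \<epsilon> n))" by simp
  next
    fix n :: nat and g :: "nat \<Rightarrow> 'a dual"
    assume g: "\<And>m. m < n \<Longrightarrow> g m \<in> C m \<and> (\<forall>k\<in>C m. \<psi> g m (g m) \<le> \<psi> g m k + \<epsilon> m)"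
    have "\<phi> 0 - K * 2 \<le> \<psi> g n k" if k: "k \<in> C n" for k
    proof -
      have "norm (g i) \<le> 1" if "i < n" for i using g[OF that] C1 by blast
      then have "(\<Sum>i<Suc n. weight i *\<^sub>R (g(n := k)) i) + remainder (Suc n) *\<^sub>R 0 \<in> cball 0 1"
        using C1[OF k] by (intro weighted_sum_in_hull) auto
      then have "norm ((\<Sum>i<n. weight i *\<^sub>R g i) + weight n *\<^sub>R k) \<le> 1"
        by (simp cong: sum.cong_simp)
      then have dom: "(\<Sum>i<n. weight i *\<^sub>R g i) + weight n *\<^sub>R k - (1 - remainder (Suc n)) *\<^sub>R h \<in> cball 0 2"
        by (rule diff_in_domain[OF _ h]) (use remainder_pos remainder_le_1 less_imp_le in auto)
      then have "K * norm ((\<Sum>i<n. weight i *\<^sub>R g i) + weight n *\<^sub>R k - (1 - remainder (Suc n)) *\<^sub>R h) \<le> K * 2"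
        using K_pos by (intro mult_left_mono) auto
      then show ?thesis
        using lipschitz[OF _ dom, of 0] by (simp add: \<psi>_def norm_minus_commute)
    qed
    then have bdd: "bdd_below (\<psi> g n ` C n)" by (rule bdd_belowI2)
    have "C n \<noteq> {}" by (auto simp: C_def)
    from near_minimizer[OF this bdd \<epsilon>]
    show "\<exists>r. r \<in> C n \<and> (\<forall>k\<in>C n. \<psi> g n r \<le> \<psi> g n k + \<epsilon> n)" by metis
  qed
  then obtain g where g: "\<And>n. g n \<in> C n" "\<And>n k. k \<in> C n \<Longrightarrow> \<psi> g n (g n) \<le> \<psi> g n k + \<epsilon> n" by blast
  show ?thesis
    by (rule that[of g]) (use g in \<open>auto simp: C_def \<psi>_def\<close>)
qed

text \<open>
  Let \<open>u n\<close> be the partial sums of the series with terms \<open>weight i *\<^sub>R g i\<close>. By the choice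
  of \<open>g\<close> and the convexity of \<open>\<phi>\<close>, the value \<open>\<phi> (u n - (1 - remainder n) *\<^sub>R h0)\<close> grows by
  at least \<open>weight n * (\<theta> / 2)\<close> at each step, and by stability the same holds with \<open>h0\<close>
  replaced by a limit functional \<open>h\<close> of \<open>g\<close> itself. So \<open>\<phi>\<close> at the limit \<open>w\<close> of these points
  exceeds its value at the \<open>n\<close>-th point by at least \<open>weight n * (\<theta> / 2)\<close>. If \<open>x\<close> is a
  subgradient at \<open>w\<close>, then \<open>x\<close> must see this growth: the later terms being negligible,
  \<open>g n x - h x\<close> is eventually bounded below by a positive constant. This is impossible
  because \<open>h x\<close> is not below the lower limit of \<open>g n x\<close>.
\<close>

lemma no_uniform_increase:
  fixes f :: "nat \<Rightarrow> 'a dual"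
  assumes f: "\<And>n. norm (f n) \<le> 1" and \<theta>: "0 < \<theta>"
    and stable: "\<And>v n h h'. v \<in> convex hull (insert 0 (range f)) \<Longrightarrow> h \<in> limit_functionals f \<Longrightarrow>
      h' \<in> limit_functionals f \<Longrightarrow>
      \<phi> (v - (1 - remainder n) *\<^sub>R h) = \<phi> (v - (1 - remainder n) *\<^sub>R h')"
    and increase: "\<And>k h. k \<in> convex hull (range f) \<Longrightarrow> h \<in> limit_functionals f \<Longrightarrow>
      \<phi> 0 + \<theta> / 2 \<le> \<phi> ((1 / 2) *\<^sub>R (k - h))"
  shows False
proof -
  define C where "C n = convex hull (f ` {n..})" for n
  define H where "H = convex hull (insert 0 (range f))"
  have CH: "C n \<subseteq> H" for n unfolding C_def H_def by (rule hull_mono) auto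
  have C_anti: "C n \<subseteq> C m" if "m \<le> n" for m n unfolding C_def by (rule hull_mono) (use that in auto)
  have convH: "convex H" and convC: "convex (C n)" for n by (simp_all add: H_def C_def)
  have H0: "0 \<in> H" unfolding H_def by (rule hull_inc) simp
  have "H \<subseteq> cball 0 1" unfolding H_def by (rule hull_minimal) (auto simp: f)
  then have H1: "norm v \<le> 1" if "v \<in> H" for v using that by auto
  obtain h0 where h0: "h0 \<in> limit_functionals f" using limit_functionals_nonempty[of f] f by blast
  have nh: "norm h \<le> 1" if "h \<in> limit_functionals f" for h
    using limit_functionals_norm_le[OF that f] .
  define b where "b n = 1 - remainder n" for n
  have b: "0 \<le> b n" "b n \<le> 1" for n
    using remainder_pos[of n] remainder_le_1[of n] by (auto simp: b_def)
  have b_Suc: "b (Suc n) = b n + weight n" for n by (simp add: b_def weight_def)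
  \<comment> \<open>slightly decreasing growth rates leave room for the errors in the near-minimisations\<close>
  define \<alpha> where "\<alpha> n = \<theta> / 2 * (1 + (1 / 2) ^ n)" for n
  have \<alpha>_Suc: "\<alpha> (Suc n) < \<alpha> n" for n using \<theta> by (simp add: \<alpha>_def)
  have \<alpha>_ge: "\<theta> / 2 \<le> \<alpha> n" for n using \<theta> by (simp add: \<alpha>_def)
  have slack: "0 < weight (Suc n) * (\<alpha> n - \<alpha> (Suc n))" for n using weight_pos \<alpha>_Suc by simp
  obtain g where gC: "\<And>n. g n \<in> C n"
    and g_min: "\<And>n k. k \<in> C n \<Longrightarrow> \<phi> ((\<Sum>i<Suc n. weight i *\<^sub>R g i) - b (Suc n) *\<^sub>R h0)
       \<le> \<phi> ((\<Sum>i<n. weight i *\<^sub>R g i) + weight n *\<^sub>R k - b (Suc n) *\<^sub>R h0) + weight (Suc n) * (\<alpha> n - \<alpha> (Suc n))"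
    by (rule near_minimizing_blocks[of f h0 "\<lambda>n. weight (Suc n) * (\<alpha> n - \<alpha> (Suc n))",
          OF f nh[OF h0] slack, folded C_def b_def]) (rule that)
  define u where "u n = (\<Sum>i<n. weight i *\<^sub>R g i)" for n
  have u_Suc: "u (Suc n) = u n + weight n *\<^sub>R g n" for n by (simp add: u_def)
  have uz: "u n + remainder n *\<^sub>R z \<in> H" if "z \<in> H" for n z
    unfolding u_def using gC CH that by (intro weighted_sum_in_hull[OF convH]) auto
  have uH: "u n \<in> H" for n using uz[OF H0, of n] by simp
  note dom = diff_in_domain[OF H1 nh b]
  have uk: "u n + weight n *\<^sub>R k \<in> H" if "k \<in> H" for n k
  proof -
    have "(\<Sum>i<Suc n. weight i *\<^sub>R (g(n := k)) i) + remainder (Suc n) *\<^sub>R 0 \<in> H"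
      using gC CH that H0 by (intro weighted_sum_in_hull[OF convH]) auto
    then show ?thesis by (simp add: u_def cong: sum.cong_simp)
  qed
  have step: "\<phi> (u n - b n *\<^sub>R h0) + weight n * \<alpha> n \<le> \<phi> (u n + weight n *\<^sub>R k - b (Suc n) *\<^sub>R h0)"
    if "k \<in> C n" for n k
    using that
  proof (induction n arbitrary: k)
    case 0
    have initial: "weight 0 = 1 / 2" "b 0 = 0" "b (Suc 0) = 1 / 2"
      by (simp_all add: weight_def b_def remainder_def)
    have "k \<in> convex hull (range f)" using 0 by (simp add: C_def)
    then show ?case
      using increase[OF _ h0, of k] unfolding initial by (simp add: u_def \<alpha>_def scaleR_diff_right)
  next
    case (Suc n)
    define s t where "s = weight n" and "t = weight (Suc n)"
    have st: "0 < s" "0 < t" by (simp_all add: s_def t_def weight_pos)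
    \<comment> \<open>\<open>k'\<close> competes with \<open>g n\<close>, and it is chosen so that \<open>W\<close> lies on the segment from \<open>X\<close> to \<open>Z\<close>\<close>
    define k' where "k' = (s / (s + t)) *\<^sub>R g n + (t / (s + t)) *\<^sub>R k"
    define X where "X = u n - b n *\<^sub>R h0"
    define Z where "Z = u (Suc n) + t *\<^sub>R k - b (Suc (Suc n)) *\<^sub>R h0"
    define W where "W = u n + s *\<^sub>R k' - b (Suc n) *\<^sub>R h0"
    have kn: "k \<in> C n" using Suc.prems C_anti[of n "Suc n"] by auto
    have "k' \<in> C n" unfolding k'_def
      using gC[of n] kn st by (intro convexD[OF convC]) (auto simp flip: add_divide_distrib)
    from Suc.IH[OF this] have incr: "\<phi> X + s * \<alpha> n \<le> \<phi> W" by (simp add: X_def W_def s_def)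
    have XS: "X \<in> cball 0 2" unfolding X_def using uH h0 by (rule dom)
    have ZS: "Z \<in> cball 0 2" unfolding Z_def t_def
      by (rule dom[OF uk h0]) (use kn CH in blast)
    have "W = X + s *\<^sub>R (k' - h0)" by (simp add: W_def X_def b_Suc s_def algebra_simps)
    also have "s *\<^sub>R (k' - h0) = (s / (s + t)) *\<^sub>R (s *\<^sub>R (g n - h0) + t *\<^sub>R (k - h0))"
    proof -
      have "k' - h0 = (1 / (s + t)) *\<^sub>R (s *\<^sub>R (g n - h0) + t *\<^sub>R (k - h0))"
      proof -
        have "h0 = (1 / (s + t)) *\<^sub>R (s *\<^sub>R h0 + t *\<^sub>R h0)"
          using st by (simp flip: scaleR_add_left)
        then show ?thesis
          unfolding k'_def by (simp add: scaleR_add_right scaleR_diff_right algebra_simps)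
      qed
      then show ?thesis by simp
    qed
    also have "s *\<^sub>R (g n - h0) + t *\<^sub>R (k - h0) = Z - X"
      by (simp add: Z_def X_def u_Suc b_Suc s_def t_def algebra_simps)
    finally have "W = X + (s / (s + t)) *\<^sub>R (Z - X)" .
    moreover have "t / (s + t) = 1 - s / (s + t)" using st by (simp add: field_simps)
    ultimately have W: "W = (t / (s + t)) *\<^sub>R X + (s / (s + t)) *\<^sub>R Z"
      by (simp only: scaleR_diff_left scaleR_diff_right) simp
    have "\<phi> W + t * \<alpha> n \<le> \<phi> Z"
      by (rule convex_on_increment[OF convex XS ZS st W incr])
    moreover have "\<phi> (u (Suc n) - b (Suc n) *\<^sub>R h0) \<le> \<phi> W + t * (\<alpha> n - \<alpha> (Suc n))"
      using g_min[OF \<open>k' \<in> C n\<close>] by (simp add: W_def u_def s_def t_def)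
    ultimately show ?case by (simp add: Z_def t_def algebra_simps)
  qed
  have g1: "norm (g n) \<le> 1" for n using H1 gC CH by blast
  obtain h where h: "h \<in> limit_functionals g"
    using limit_functionals_nonempty[of g] g1 by blast
  then have hf: "h \<in> limit_functionals f"
    using limit_functionals_convex_blocks[of g f] gC by (auto simp: C_def)
  \<comment> \<open>\<open>g\<close> was built with \<open>h0\<close>, but the contradiction needs a limit functional of \<open>g\<close>, which is
      known only now; stability allows the exchange\<close>
  define p where "p n = u n - b n *\<^sub>R h" for n
  have pS: "p n \<in> cball 0 2" for n unfolding p_def using uH hf by (rule dom)
  have p_step: "\<phi> (p n) + weight n * (\<theta> / 2) \<le> \<phi> (p (Suc n))" for n
  proof -
    have "\<phi> (u n - b n *\<^sub>R h0) = \<phi> (p n)" for n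
      unfolding p_def b_def by (rule stable[OF uH[unfolded H_def] h0 hf])
    then have "\<phi> (p n) + weight n * \<alpha> n \<le> \<phi> (p (Suc n))"
      using step[OF gC, of n] by (simp flip: u_Suc)
    moreover have "weight n * (\<theta> / 2) \<le> weight n * \<alpha> n"
      using \<alpha>_ge weight_pos[of n] by (intro mult_left_mono) auto
    ultimately show ?thesis by linarith
  qed
  obtain U where lim: "u \<longlonglongrightarrow> U" and tail: "\<And>n. norm (U - u n) \<le> remainder n"
    by (rule weighted_sum_tail[of g, OF g1, folded u_def]) (rule that)
  define w where "w = U - h"
  have "b \<longlonglongrightarrow> 1 - 0" unfolding b_def[abs_def] by (intro tendsto_intros remainder_tendsto_0)
  then have p_lim: "p \<longlonglongrightarrow> w"
    using tendsto_diff[OF lim tendsto_scaleR[OF _ tendsto_const[of h]], of b 1]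
    by (simp add: p_def[abs_def] w_def)
  have wS: "w \<in> cball 0 2"
    using closed_sequentially[OF closed_cball pS p_lim] .
  have "incseq (\<lambda>n. \<phi> (p n))"
  proof (rule incseq_SucI)
    fix n show "\<phi> (p n) \<le> \<phi> (p (Suc n))"
      using p_step[of n] mult_pos_pos[OF weight_pos[of n] half_gt_zero[OF \<theta>]] by linarith
  qed
  have p_le: "\<phi> (p n) \<le> \<phi> w" for n
  proof (rule tendsto_lowerbound)
    show "(\<lambda>m. \<phi> w + K * norm (p m - w)) \<longlonglongrightarrow> \<phi> w"
      using tendsto_add[OF tendsto_const[of "\<phi> w"] tendsto_mult[OF tendsto_const[of K] tendsto_norm[OF LIM_zero[OF p_lim]]]]
      by simp
    show "\<forall>\<^sub>F m in sequentially. \<phi> (p n) \<le> \<phi> w + K * norm (p m - w)"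
      using eventually_ge_at_top[of n]
    proof eventually_elim
      case (elim m)
      then show ?case
        using incseqD[OF \<open>incseq (\<lambda>n. \<phi> (p n))\<close>, of n m] lipschitz[OF pS[of m] wS] by linarith
    qed
  qed simp
  define x where "x = subgradient w"
  have gap: "\<theta> / 2 - 2 * norm x / real (n + 1) \<le> blinfun_apply (g n) x - blinfun_apply h x" for n
  proof -
    have app: "blinfun_apply k x \<le> c * norm x" if "norm k \<le> c" for k :: "'a dual" and c
      using norm_blinfun[of k x] mult_right_mono[OF that, of "norm x"] by simp
    have "\<phi> w + blinfun_apply (p n - w) x \<le> \<phi> (p n)"
      unfolding x_def using subgradient_le[OF wS pS] .
    then have 1: "weight n * (\<theta> / 2) \<le> blinfun_apply (w - p n) x"
      using p_step[of n] p_le[of "Suc n"] by (simp add: blinfun.bilinear_simps)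
    have "w - p n = weight n *\<^sub>R (g n - h) + (U - u (Suc n)) - remainder (Suc n) *\<^sub>R h"
      by (simp add: w_def p_def u_Suc b_def weight_def algebra_simps)
    then have "blinfun_apply (w - p n) x = weight n * blinfun_apply (g n - h) x
        + blinfun_apply (U - u (Suc n)) x + remainder (Suc n) * blinfun_apply (- h) x"
      by (simp add: blinfun.bilinear_simps)
    moreover have "remainder (Suc n) * blinfun_apply (- h) x \<le> remainder (Suc n) * (1 * norm x)"
      using nh[OF hf] remainder_pos[of "Suc n"] by (intro mult_left_mono app) auto
    moreover have "blinfun_apply (U - u (Suc n)) x \<le> remainder (Suc n) * norm x"
      by (rule app[OF tail])
    ultimately have "weight n * (\<theta> / 2) \<le> weight n * blinfun_apply (g n - h) x + 2 * remainder (Suc n) * norm x"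
      using 1 by linarith
    also have "2 * remainder (Suc n) * norm x = weight n * (2 * norm x / real (n + 1))"
      by (simp add: weight_eq field_simps)
    finally have "weight n * (\<theta> / 2) \<le> weight n * (blinfun_apply (g n - h) x + 2 * norm x / real (n + 1))"
      by (simp add: distrib_left)
    then have "\<theta> / 2 \<le> blinfun_apply (g n - h) x + 2 * norm x / real (n + 1)"
      using weight_pos[of n] by simp
    then show ?thesis by (simp add: blinfun.bilinear_simps)
  qed
  have "(\<lambda>n. 2 * norm x * (1 / real (Suc n))) \<longlonglongrightarrow> 2 * norm x * 0"
    by (intro tendsto_intros lim_1_over_n LIMSEQ_Suc)
  then have "\<forall>\<^sub>F n in sequentially. 2 * norm x / real (n + 1) < \<theta> / 4"
    using \<theta> by (intro order_tendstoD(2)[of _ 0]) auto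
  then have "\<forall>\<^sub>F n in sequentially. blinfun_apply h x + \<theta> / 4 \<le> blinfun_apply (g n) x"
  proof eventually_elim
    case (elim n)
    then show ?case using gap[of n] by linarith
  qed
  from limit_functionals_lower[OF h this] show False using \<theta> by simp
qed

text \<open>
  If \<open>F\<close> had positive distance from the image of the space, a subsequence of the sequence
  annihilating the subgradients would contradict no_uniform_increase: \<open>F\<close> is at least \<open>\<theta>\<close> on
  its convex hull, so \<open>\<phi>\<close> increases by at least \<open>\<theta> / 2\<close> from 0 to \<open>k / 2\<close>, and subtracting
  \<open>h / 2\<close> does not decrease it.
\<close>

theorem bidual_subgradient_at_0:
  assumes F: "\<And>y. y \<in> cball 0 2 \<Longrightarrow> blinfun_apply F y \<le> \<phi> y - \<phi> 0"
  shows "F \<in> range hat"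
proof (rule ccontr)
  assume "F \<notin> range hat"
  then have "0 < infdist F (range hat)"
    using in_closed_iff_infdist_zero[OF closed_range_hat, of F] infdist_nonneg[of F "range hat"]
    by (metis UNIV_not_empty image_is_empty order_le_less)
  then obtain \<theta> where \<theta>: "0 < \<theta>" "\<theta> < infdist F (range hat)" using dense by blast
  obtain f Q where f: "\<And>n. norm (f n) \<le> 1" "\<And>n. \<theta> < blinfun_apply F (f n)"
    and Q: "countable Q" "Q \<subseteq> convex hull (insert 0 (range f))" "convex hull (insert 0 (range f)) \<subseteq> closure Q"
    and zero: "\<And>y. y \<in> Q \<Longrightarrow> \<forall>\<^sub>F n in sequentially. blinfun_apply (f n) (subgradient y) = 0"
    using sequence_vanishing_on_subgradients[OF less_imp_le[OF \<theta>(1)] \<theta>(2)] by metis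
  have "convex hull (insert 0 (range f)) \<subseteq> cball 0 1" by (rule hull_minimal) (auto simp: f)
  then have Q1: "Q \<subseteq> cball 0 1" using Q(2) by blast
  have range_01: "0 \<le> 1 - remainder n" "1 - remainder n \<le> 1" for n
    using remainder_le_1[of n] remainder_pos[of n] by simp_all
  obtain r where r: "strict_mono r"
    and stable: "\<And>v n h h'. v \<in> closure Q \<Longrightarrow> h \<in> limit_functionals (f \<circ> r) \<Longrightarrow> h' \<in> limit_functionals (f \<circ> r)
       \<Longrightarrow> \<phi> (v - (1 - remainder n) *\<^sub>R h) = \<phi> (v - (1 - remainder n) *\<^sub>R h')"
    by (rule subseq_no_oscillation[of f Q "\<lambda>n. 1 - remainder n", OF f(1) Q(1) Q1 range_01])
      (rule that)
  have mono: "convex hull (insert 0 (range (f \<circ> r))) \<subseteq> convex hull (insert 0 (range f))"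
    by (rule hull_mono) auto
  show False
  proof (rule no_uniform_increase[of "f \<circ> r" \<theta>])
    show "norm ((f \<circ> r) n) \<le> 1" for n using f(1) by simp
    show "0 < \<theta>" by fact
    show "\<phi> (v - (1 - remainder n) *\<^sub>R h) = \<phi> (v - (1 - remainder n) *\<^sub>R h')"
      if "v \<in> convex hull (insert 0 (range (f \<circ> r)))" "h \<in> limit_functionals (f \<circ> r)"
        "h' \<in> limit_functionals (f \<circ> r)" for v n h h'
      by (rule stable[OF _ that(2,3)]) (use that(1) mono Q(3) in blast)
  next
    fix k h assume k: "k \<in> convex hull (range (f \<circ> r))" and h: "h \<in> limit_functionals (f \<circ> r)"
    have "convex {k. \<theta> \<le> blinfun_apply F k}"
    proof (rule convexI)
      fix j k and s t :: real
      assume *: "j \<in> {k. \<theta> \<le> blinfun_apply F k}" "k \<in> {k. \<theta> \<le> blinfun_apply F k}" "0 \<le> s" "0 \<le> t" "s + t = 1"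
      have "\<theta> = s * \<theta> + t * \<theta>" using *(5) by (simp flip: distrib_right)
      also have "\<dots> \<le> s * blinfun_apply F j + t * blinfun_apply F k"
        using * by (intro add_mono mult_left_mono) auto
      finally show "s *\<^sub>R j + t *\<^sub>R k \<in> {k. \<theta> \<le> blinfun_apply F k}"
        by (simp add: blinfun.bilinear_simps)
    qed
    then have "convex hull (range (f \<circ> r)) \<subseteq> {k. \<theta> \<le> blinfun_apply F k}"
      by (intro hull_minimal) (auto simp: f less_imp_le)
    then have Fk: "\<theta> \<le> blinfun_apply F k" using k by blast
    have kH: "k \<in> convex hull (insert 0 (range f))"
      using k mono hull_mono[of "range (f \<circ> r)" "insert 0 (range (f \<circ> r))" convex] by blast
    have "(1 / 2) *\<^sub>R k + (1 / 2) *\<^sub>R 0 \<in> convex hull (insert 0 (range f))"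
      using kH by (intro convexD[OF convex_convex_hull]) (auto intro: hull_inc)
    then have v: "(1 / 2) *\<^sub>R k \<in> convex hull (insert 0 (range f))" by simp
    then have "(1 / 2) *\<^sub>R k \<in> cball 0 1" using \<open>convex hull (insert 0 (range f)) \<subseteq> cball 0 1\<close> by blast
    then have "\<phi> 0 + blinfun_apply F ((1 / 2) *\<^sub>R k) \<le> \<phi> ((1 / 2) *\<^sub>R k)"
      using F[of "(1 / 2) *\<^sub>R k"] by simp
    also have "\<dots> \<le> \<phi> ((1 / 2) *\<^sub>R k - (1 / 2) *\<^sub>R h)"
    proof (rule le_after_subtracting_limit_functional[OF f(1) Q1 zero])
      show "h \<in> limit_functionals f" using h limit_functionals_subseq[OF r] by blast
      show "(1 / 2) *\<^sub>R k \<in> closure Q" using v Q(3) by blast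
    qed auto
    finally show "\<phi> 0 + \<theta> / 2 \<le> \<phi> ((1 / 2) *\<^sub>R (k - h))"
      using Fk by (simp add: blinfun.bilinear_simps scaleR_diff_right)
  qed
qed

end

section \<open>The local reduction\<close>

text \<open>
  A subgradient at a point of the smaller ball has norm at most 2, because it bounds the
  growth of \<open>\<psi>\<close> over distance 1, and \<open>\<psi>\<close> varies by at most 2 on the larger ball.
\<close>

lemma lipschitz_with_subgradients_if_bounded:
  fixes \<psi> :: "('a::banach) dual \<Rightarrow> real"
  assumes convex: "convex_on (cball 0 2) \<psi>"
    and bounded: "\<And>y. y \<in> cball 0 3 \<Longrightarrow> \<bar>\<psi> y - \<psi> 0\<bar> \<le> 1"
    and subgrad: "\<And>y. y \<in> cball 0 2 \<Longrightarrow>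
      \<exists>x. \<forall>z\<in>cball 0 3. blinfun_apply z x - blinfun_apply y x \<le> \<psi> z - \<psi> y"
  shows "lipschitz_with_subgradients \<psi> 2"
proof
  fix y z :: "'a dual" assume y: "y \<in> cball 0 2" and z: "z \<in> cball 0 2"
  obtain x where x: "\<And>w. w \<in> cball 0 3 \<Longrightarrow> blinfun_apply w x - blinfun_apply y x \<le> \<psi> w - \<psi> y"
    using subgrad[OF y] by blast
  have unit: "blinfun_apply d x \<le> 2" if "norm d \<le> 1" for d :: "'a dual"
  proof -
    have yd: "y + d \<in> cball 0 3" using norm_triangle_ineq[of y d] y that by simp
    have "blinfun_apply d x \<le> \<psi> (y + d) - \<psi> y" using x[OF yd] by (simp add: blinfun.bilinear_simps)
    also have "\<dots> \<le> 2" using bounded[OF yd] bounded[of y] y by simp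
    finally show ?thesis .
  qed
  have "blinfun_apply (y - z) x \<le> 2 * norm (y - z)"
  proof (cases "y = z")
    case False
    then have "norm ((1 / norm (y - z)) *\<^sub>R (y - z)) \<le> 1" by simp
    from unit[OF this] False show ?thesis by (simp add: blinfun.bilinear_simps field_simps)
  qed simp
  then show "\<psi> y \<le> \<psi> z + 2 * norm (y - z)"
    using x[of z] z by (simp add: blinfun.bilinear_simps)
next
  fix y :: "'a dual" assume "y \<in> cball 0 2"
  from subgrad[OF this] show "\<exists>x. \<forall>z\<in>cball 0 2. blinfun_apply z x - blinfun_apply y x \<le> \<psi> z - \<psi> y"
    by force
qed (use convex in auto)

theorem theorem4p13:
  fixes A :: "('a::banach) dual set"
    and \<phi> :: "'a dual \<Rightarrow> real"
  assumes "A \<noteq> {}" and "open A" and "convex A"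
    and "continuous_on A \<phi>" and "convex_on A \<phi>"
    and "\<forall>x\<in>A. subdiff A \<phi> x \<inter> range hat \<noteq> {}"
  shows "\<forall>x\<in>A. subdiff A \<phi> x \<subseteq> range hat"
proof (intro ballI subsetI)
  fix x0 F assume x0: "x0 \<in> A" and F: "F \<in> subdiff A \<phi> x0"
  obtain R1 where R1: "0 < R1" "ball x0 R1 \<subseteq> A" using assms(2) x0 by (metis open_contains_ball)
  obtain R2 where R2: "0 < R2" "\<And>y. y \<in> A \<Longrightarrow> dist y x0 < R2 \<Longrightarrow> dist (\<phi> y) (\<phi> x0) < 1"
    using assms(4) x0 zero_less_one unfolding continuous_on_iff by blast
  \<comment> \<open>the ball of radius 3 is scaled into the ball of radius \<open>min R1 R2 / 2\<close>\<close>
  define r where "r = min R1 R2 / 6"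
  have r: "0 < r" using R1 R2 by (simp add: r_def)
  define \<psi> where "\<psi> y = \<phi> (x0 + r *\<^sub>R y)" for y
  have near: "dist (x0 + r *\<^sub>R y) x0 < min R1 R2" if "y \<in> cball 0 3" for y
  proof -
    have "r * norm y \<le> r * 3" using that r by (intro mult_left_mono) auto
    also have "\<dots> < min R1 R2" using R1(1) R2(1) by (simp add: r_def min_def)
    finally show ?thesis using r by (simp add: dist_norm)
  qed
  have inA: "x0 + r *\<^sub>R y \<in> A" if "y \<in> cball 0 3" for y
    using near[OF that] R1(2) by (auto simp: dist_commute)
  have sub32: "y \<in> cball 0 3" if "y \<in> cball 0 2" for y :: "'a dual" using that by simp
  interpret lipschitz_with_subgradients \<psi> 2
  proof (rule lipschitz_with_subgradients_if_bounded)
    show "convex_on (cball 0 2) \<psi>"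
    proof (rule convex_onI)
      fix t :: real and y z :: "'a dual"
      assume t: "0 < t" "t < 1" and "y \<in> cball 0 2" "z \<in> cball 0 2"
      then have "\<phi> ((1 - t) *\<^sub>R (x0 + r *\<^sub>R y) + t *\<^sub>R (x0 + r *\<^sub>R z)) \<le> (1 - t) * \<psi> y + t * \<psi> z"
        unfolding \<psi>_def by (intro convex_onD[OF assms(5)] inA sub32) auto
      moreover have "(1 - t) *\<^sub>R (x0 + r *\<^sub>R y) + t *\<^sub>R (x0 + r *\<^sub>R z) = x0 + r *\<^sub>R ((1 - t) *\<^sub>R y + t *\<^sub>R z)"
        by (simp add: algebra_simps)
      ultimately show "\<psi> ((1 - t) *\<^sub>R y + t *\<^sub>R z) \<le> (1 - t) * \<psi> y + t * \<psi> z"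
        by (simp add: \<psi>_def)
    qed simp
  next
    fix y :: "'a dual" assume y: "y \<in> cball 0 3"
    then show "\<bar>\<psi> y - \<psi> 0\<bar> \<le> 1"
      using R2(2)[OF inA[OF y]] near[OF y] by (simp add: \<psi>_def dist_real_def less_imp_le)
  next
    fix y :: "'a dual" assume "y \<in> cball 0 2"
    then have y: "x0 + r *\<^sub>R y \<in> A" by (intro inA sub32)
    then obtain e where e: "hat e \<in> subdiff A \<phi> (x0 + r *\<^sub>R y)" using assms(6) by blast
    show "\<exists>x. \<forall>z\<in>cball 0 3. blinfun_apply z x - blinfun_apply y x \<le> \<psi> z - \<psi> y"
    proof (intro exI ballI)
      fix z :: "'a dual" assume "z \<in> cball 0 3"
      then show "blinfun_apply z (r *\<^sub>R e) - blinfun_apply y (r *\<^sub>R e) \<le> \<psi> z - \<psi> y"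
        using e inA[of z] by (force simp: subdiff_def \<psi>_def blinfun.bilinear_simps)
    qed
  qed
  have "r *\<^sub>R F \<in> range hat"
  proof (rule bidual_subgradient_at_0)
    fix y :: "'a dual" assume "y \<in> cball 0 2"
    then show "blinfun_apply (r *\<^sub>R F) y \<le> \<psi> y - \<psi> 0"
      using F inA[OF sub32, of y] by (force simp: subdiff_def \<psi>_def blinfun.bilinear_simps)
  qed
  then obtain e where e: "r *\<^sub>R F = hat e" by blast
  have "hat ((1 / r) *\<^sub>R e) = (1 / r) *\<^sub>R (r *\<^sub>R F)"
    unfolding e by (rule linear_scale[OF linear_hat])
  also have "\<dots> = F" using r by simp
  finally have "F = hat ((1 / r) *\<^sub>R e)" by (rule sym)
  then show "F \<in> range hat" by blast
qed

end
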